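(* Let $d\in\mathbb{N}$, $p$ a kernel and $\xi$ noise as in the context. Then for every $u\in\mathcal{H}_d$ the measure $\pi_u$ is an extreme point of $\mathcal{I}$. Moreover, for any $\nu\in\mathcal{I}$ under which each $\eta(x-e_i,x)$ has finite mean and variance, \[\mathrm{Var}^\nu[\eta(x-e_i,x)]\ge\mathrm{Var}^{\pi_0}[\eta(x-e_i,x)]\quad\text{for all }x\in\mathbb{Z}^d,\ i\in\{1,\dots,d\},\] and equality holds for all $i$ and $x$ if and only if $\nu\in\{\pi_u:u\in\mathcal{H}_d\}$.
   Context: The kernel $p:\mathbb{Z}^d\to[0,1)$ satisfies $\sum_x p(x)=1$, $p(x)=0$ for $|x|>M$ for some $M<\infty$, and strong aperiodicity: for every $u\in\mathbb{Z}^d$ the smallest additive subgroup of $\mathbb{Z}^d$ containing $\{u+x:p(x)>0\}$ is $\mathbb{Z}^d$; $p(x,y)=p(y-x)$ and $p^k$ is the $k$-step transition. $\xi=\{\xi_t(x)\}_{t\in\mathbb{Z},x\in\mathbb{Z}^d}$ are i.i.d. real, mean zero, finite variance. The increment process is the Markov chain on $(\mathbb{R}^d)^{\mathbb{Z}^d}$, with configurations $\eta=\{\eta(x)\}_x$, $\eta(x)=(\eta(x-e_i,x))_{i=1}^d$, evolving by $\eta_{t+1}(x-e_i,x)=\sum_z p(0,z)\eta_t(x+z-e_i,x+z)+\xi_{t+1}(x)-\xi_{t+1}(x-e_i)$ with $\xi_{t+1}$ independent of $\eta_t$ (no additivity is required). $\mathcal{I}$ is the set of probability measures on $(\mathbb{R}^d)^{\mathbb{Z}^d}$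 invariant for this chain. $\Delta_0(x-e_i,x)=\sum_{k\ge 0}\sum_z\xi_{-k}(z)(p^k(x,z)-p^k(x-e_i,z))$ (convergent a.s. and in $L^2$). A function $v:\mathbb{Z}^d\to\mathbb{R}$ is harmonic if $\sum_y p(x,y)v(y)=v(x)$ for all $x$; $\mathcal{H}_d$ is the set of $u=(u_1,\dots,u_d)$ with each $u_i:\mathbb{Z}^d\to\mathbb{R}$ harmonic. For $u\in\mathcal{H}_d$, $\pi_u$ is the law of the configuration $\{u_i(x)+\Delta_0(x-e_i,x)\}_{x,i}$; $\pi_0$ is the case $u=0$. An extreme point of $\mathcal{I}$ is $\pi\in\mathcal{I}$ such that $\pi=b\mu+(1-b)\nu$ with $0<b<1$, $\mu,\nu\in\mathcal{I}$ forces $\mu=\nu=\pi$. *)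

theory Defs
  imports "HOL-Probability.Probability"
begin

text \<open>Sites of Z^d are vectors int^'d ('d a finite type, d = CARD('d) \<ge> 1).
 A configuration eta is a real function of pairs (x,i), where eta (x,i) stands for
 the increment eta(x - e_i, x).\<close>

type_synonym 'd config = "(int ^ 'd) \<times> 'd \<Rightarrow> real"

definition unitv :: "'d::finite \<Rightarrow> int ^ 'd" where
  "unitv i = axis i 1"

definition add_subgroup_generated :: "(int ^ 'd::finite) set \<Rightarrow> (int ^ 'd) set" where
  "add_subgroup_generated A =
     \<Inter>{G. 0 \<in> G \<and> (\<forall>a\<in>G. \<forall>b\<in>G. a - b \<in> G) \<and> A \<subseteq> G}"

definition kernel :: "(int ^ 'd::finite \<Rightarrow> real) \<Rightarrow> bool" where
  "kernel p \<longleftrightarrow>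
     (\<forall>x. 0 \<le> p x \<and> p x < 1) \<and>
     (p has_sum 1) UNIV \<and>
     (\<exists>M::int. \<forall>x. (\<exists>i. M < \<bar>x $ i\<bar>) \<longrightarrow> p x = 0) \<and>
     (\<forall>u. add_subgroup_generated {u + x | x. p x > 0} = UNIV)"

definition noise_law :: "real measure \<Rightarrow> bool" where
  "noise_law \<mu> \<longleftrightarrow> prob_space \<mu> \<and> sets \<mu> = sets borel \<and>
     integrable \<mu> (\<lambda>t. t) \<and> integrable \<mu> (\<lambda>t. t\<^sup>2) \<and> (\<integral>t. t \<partial>\<mu>) = 0"

text \<open>k-step kernel: pk p k (y - x) = p^k(x,y).\<close>
fun pk :: "(int ^ 'd::finite \<Rightarrow> real) \<Rightarrow> nat \<Rightarrow> int ^ 'd \<Rightarrow> real" where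
  "pk p 0 y = (if y = 0 then 1 else 0)"
| "pk p (Suc k) y = (\<Sum>\<^sub>\<infinity>z. p z * pk p k (y - z))"

definition config_space :: "('d::finite) config measure" where
  "config_space = PiM UNIV (\<lambda>_. borel)"

definition noise_field :: "real measure \<Rightarrow> (int ^ 'd::finite \<Rightarrow> real) measure" where
  "noise_field \<mu> = PiM UNIV (\<lambda>_. \<mu>)"

definition step :: "(int ^ 'd::finite \<Rightarrow> real) \<Rightarrow> 'd config \<Rightarrow> (int ^ 'd \<Rightarrow> real) \<Rightarrow> 'd config" where
  "step p \<eta> \<xi> = (\<lambda>(x, i). (\<Sum>\<^sub>\<infinity>z. p z * \<eta> (x + z, i)) + \<xi> x - \<xi> (x - unitv i))"

definition invariant_measures :: "(int ^ 'd::finite \<Rightarrow> real) \<Rightarrow> real measure \<Rightarrow> 'd config measure set" where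
  "invariant_measures p \<mu> =
     {\<nu>. prob_space \<nu> \<and> sets \<nu> = sets config_space \<and>
          distr (\<nu> \<Otimes>\<^sub>M noise_field \<mu>) config_space (\<lambda>(\<eta>, \<xi>). step p \<eta> \<xi>) = \<nu>}"

definition harmonic :: "(int ^ 'd::finite \<Rightarrow> real) \<Rightarrow> (int ^ 'd \<Rightarrow> real) \<Rightarrow> bool" where
  "harmonic p v \<longleftrightarrow> (\<forall>x. (\<Sum>\<^sub>\<infinity>z. p z * v (x + z)) = v x)"

definition harmonic_d :: "(int ^ 'd::finite \<Rightarrow> real) \<Rightarrow> ('d \<Rightarrow> int ^ 'd \<Rightarrow> real) set" where
  "harmonic_d p = {u. \<forall>i. harmonic p (u i)}"

text \<open>Past noise: omega (k, z) = xi_{-k}(z), k \<ge> 0, all i.i.d. with law mu.\<close>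
definition noise_hist :: "real measure \<Rightarrow> (nat \<times> (int ^ 'd::finite) \<Rightarrow> real) measure" where
  "noise_hist \<mu> = PiM UNIV (\<lambda>_. \<mu>)"

definition Delta0 :: "(int ^ 'd::finite \<Rightarrow> real) \<Rightarrow> (nat \<times> (int ^ 'd) \<Rightarrow> real) \<Rightarrow> 'd config" where
  "Delta0 p \<omega> = (\<lambda>(x, i). (\<Sum>k. \<Sum>\<^sub>\<infinity>z. \<omega> (k, z) * (pk p k (z - x) - pk p k (z - (x - unitv i)))))"

definition pi_u :: "(int ^ 'd::finite \<Rightarrow> real) \<Rightarrow> real measure \<Rightarrow> ('d \<Rightarrow> int ^ 'd \<Rightarrow> real) \<Rightarrow> 'd config measure" where
  "pi_u p \<mu> u = distr (noise_hist \<mu>) config_space (\<lambda>\<omega>. \<lambda>(x, i). u i x + Delta0 p \<omega> (x, i))"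

definition extreme_point :: "'a measure set \<Rightarrow> 'a measure \<Rightarrow> bool" where
  "extreme_point I \<pi> \<longleftrightarrow> \<pi> \<in> I \<and>
     (\<forall>b \<mu> \<nu>. 0 < b \<and> b < 1 \<and> \<mu> \<in> I \<and> \<nu> \<in> I \<and>
        (\<forall>A\<in>sets \<pi>. emeasure \<pi> A = ennreal b * emeasure \<mu> A + ennreal (1 - b) * emeasure \<nu> A)
        \<longrightarrow> \<mu> = \<pi> \<and> \<nu> = \<pi>)"

definition variance_of :: "'a measure \<Rightarrow> ('a \<Rightarrow> real) \<Rightarrow> real" where
  "variance_of M X = (\<integral>\<omega>. (X \<omega> - (\<integral>\<omega>'. X \<omega>' \<partial>M))\<^sup>2 \<partial>M)"

end

theory Submission
  imports Defs
begin

text \<open>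
  Under an invariant law \<open>\<nu>\<close>, running the chain for \<open>n\<close> steps represents \<open>\<nu>\<close> as the law of \<open>P^n \<eta>\<close>, with
  \<open>\<eta>\<close> distributed as \<open>\<nu>\<close> and \<open>P\<close> averaging over the kernel, plus the first \<open>n\<close> terms of the series \<open>\<Delta>\<^sub>0\<close>.
  The two summands are independent, so the variances
  add. Letting \<open>n\<close> tend to infinity, the variance under \<open>\<nu>\<close> is at least that of \<open>\<Delta>\<^sub>0\<close>, with equality at
  all sites only if \<open>P^n \<eta>\<close> converges in \<open>L\<^sup>2\<close> to its mean, which is harmonic; then \<open>\<nu> = \<pi>\<^sub>u\<close>. Extremality
  follows because the variance of a mixture is at least the mixture of the variances, with equality
  only if the means agree.

  The variance of \<open>\<Delta>\<^sub>0\<close> is finite because the \<open>l\<^sup>2\<close> norm of \<open>p^k\<close> decreases in \<open>k\<close> by a Dirichlet form: this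
  makes the squared \<open>l\<^sup>2\<close> norms of \<open>p^k - p^k(\<cdot> - w)\<close> summable in \<open>k\<close> whenever \<open>w\<close> is a difference of two
  points of the support; the \<open>w\<close> with this property form a subgroup, which by strong aperiodicity is
  everything. Almost sure convergence of the series is
  Kolmogorov's one-series theorem.
\<close>

section \<open>Convergence of series of independent variables\<close>

text \<open>The noise is indexed backwards in time, so that the noise part of the
  \<open>n\<close>-step chain is the \<open>n\<close>-th partial sum of one fixed series. All chains
  then live on a single product space, each with law \<open>\<nu>\<close>, and they can converge
  there in L^1; with forward indexing they would converge only in law. The variance of
  \<open>Delta0\<close> is never computed. Fatou bounds it from above by the sum of the variances of
  its terms, invariance bounds the variance of every competitor from below by the same sum, and the
  comparison rests on these two inequalities. The energy argument sees only differences of support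
  points because the loss in the \<open>l^2\<close> norm is the variance of
  \<open>p^k(z - Y)\<close> over a random kernel step \<open>Y\<close>, and this compares the values
  for two independent steps. Unit vectors need not be such differences, hence the detour through
  subgroups. In a decomposition of \<open>pi_u\<close> the components come without moment
  assumptions; they inherit finite second moments from the mixture, since both weights are
  positive.\<close>

lemma integrable_mult_of_squares:
  fixes f g :: "'a \<Rightarrow> real"
  assumes [measurable]: "f \<in> borel_measurable M" "g \<in> borel_measurable M"
    and "integrable M (\<lambda>x. (f x)\<^sup>2)" "integrable M (\<lambda>x. (g x)\<^sup>2)"
  shows "integrable M (\<lambda>x. f x * g x)"
proof (rule Bochner_Integration.integrable_bound)
  show "integrable M (\<lambda>x. (f x)\<^sup>2 + (g x)\<^sup>2)"
    using assms by simp
  have "\<bar>a * b\<bar> \<le> a\<^sup>2 + b\<^sup>2" for a b :: real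
    using sum_squares_bound[of "\<bar>a\<bar>" "\<bar>b\<bar>"] abs_ge_zero[of "a * b"]
    by (simp only: abs_mult power2_abs)
  then show "AE x in M. norm (f x * g x) \<le> norm ((f x)\<^sup>2 + (g x)\<^sup>2)"
    by simp
qed simp

lemma integrable_add_square:
  fixes f g :: "'a \<Rightarrow> real"
  assumes [measurable]: "f \<in> borel_measurable M" "g \<in> borel_measurable M"
    and "integrable M (\<lambda>x. (f x)\<^sup>2)" "integrable M (\<lambda>x. (g x)\<^sup>2)"
  shows "integrable M (\<lambda>x. (f x + g x)\<^sup>2)"
proof -
  have "integrable M (\<lambda>x. (f x)\<^sup>2 + (g x)\<^sup>2 + 2 * (f x * g x))"
    using assms integrable_mult_of_squares[of f M g] by simp
  then show ?thesis by (simp add: power2_sum mult.assoc)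
qed

lemma integrable_sum_square:
  fixes f :: "'i \<Rightarrow> 'a \<Rightarrow> real"
  assumes "\<And>i. i \<in> A \<Longrightarrow> f i \<in> borel_measurable M"
    and "\<And>i. i \<in> A \<Longrightarrow> integrable M (\<lambda>x. (f i x)\<^sup>2)"
  shows "integrable M (\<lambda>x. (\<Sum>i\<in>A. f i x)\<^sup>2)"
  using assms
proof (induction A rule: infinite_finite_induct)
  case (insert a A)
  then show ?case by (auto intro!: integrable_add_square borel_measurable_sum)
qed auto

text \<open>Fatou with a uniform bound. It yields integrability of the limit as well, which is how
  the infinite series acquires a second moment.\<close>

lemma integral_Fatou_bound:
  fixes f :: "nat \<Rightarrow> 'a \<Rightarrow> real"
  assumes [measurable]: "\<And>n. f n \<in> borel_measurable M" "g \<in> borel_measurable M"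
    and int: "\<And>n. integrable M (f n)" and nonneg: "\<And>n x. 0 \<le> f n x" "\<And>x. 0 \<le> g x"
    and lim: "AE x in M. (\<lambda>n. f n x) \<longlonglongrightarrow> g x"
    and le: "\<And>n. (\<integral>x. f n x \<partial>M) \<le> C"
  shows "integrable M g" and "(\<integral>x. g x \<partial>M) \<le> C"
proof -
  have C: "0 \<le> C"
    using order_trans[OF integral_nonneg_AE le[of 0]] nonneg by simp
  have "(\<integral>\<^sup>+x. ennreal (g x) \<partial>M) = (\<integral>\<^sup>+x. liminf (\<lambda>n. ennreal (f n x)) \<partial>M)"
    using lim by (intro nn_integral_cong_AE)
      (auto elim!: eventually_mono intro!: lim_imp_Liminf[symmetric])
  also have "\<dots> \<le> liminf (\<lambda>n. \<integral>\<^sup>+x. ennreal (f n x) \<partial>M)"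
    by (rule nn_integral_liminf) simp
  also have "\<dots> \<le> ennreal C"
    by (intro Liminf_le always_eventually)
      (auto simp: nn_integral_eq_integral[OF int] nonneg intro!: ennreal_leI le)
  finally have fin: "(\<integral>\<^sup>+x. ennreal (g x) \<partial>M) \<le> ennreal C" .
  show I: "integrable M g"
    using fin by (intro integrableI_nonneg) (auto simp: nonneg less_top[symmetric] top_unique)
  show "(\<integral>x. g x \<partial>M) \<le> C"
    using fin C by (simp add: nn_integral_eq_integral[OF I] nonneg)
qed

context prob_space
begin

section \<open>Orthogonality and the maximal inequality for independent sums\<close>

lemma indep_orthogonal_past:
  fixes X :: "nat \<Rightarrow> 'a \<Rightarrow> real"
  assumes ind: "indep_vars (\<lambda>_. borel) X UNIV"
    and X: "integrable M (X j)" "expectation (X j) = 0"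
    and G[measurable]: "G \<in> borel_measurable (PiM {..<k} (\<lambda>_. borel))"
    and int: "integrable M (\<lambda>\<omega>. G (restrict (\<lambda>i. X i \<omega>) {..<k}))" and "k \<le> j"
  shows "expectation (\<lambda>\<omega>. G (restrict (\<lambda>i. X i \<omega>) {..<k}) * X j \<omega>) = 0"
proof -
  have "indep_var (PiM {..<k} (\<lambda>_. borel)) (\<lambda>\<omega>. restrict (\<lambda>i. X i \<omega>) {..<k})
      (PiM {j} (\<lambda>_. borel)) (\<lambda>\<omega>. restrict (\<lambda>i. X i \<omega>) {j})"
    using \<open>k \<le> j\<close> by (intro indep_var_restrict[OF ind]) auto
  then have "indep_var borel (G \<circ> (\<lambda>\<omega>. restrict (\<lambda>i. X i \<omega>) {..<k}))
      borel ((\<lambda>y. y j) \<circ> (\<lambda>\<omega>. restrict (\<lambda>i. X i \<omega>) {j}))"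
    by (rule indep_var_compose) simp_all
  then have "indep_var borel (\<lambda>\<omega>. G (restrict (\<lambda>i. X i \<omega>) {..<k})) borel (X j)"
    by (simp add: comp_def)
  from indep_var_lebesgue_integral[OF this int X(1)] X(2) show ?thesis by simp
qed

text \<open>Independence and centring make distinct terms orthogonal. The index type is arbitrary
  because the lemma serves both sums over times and sums over single noise coordinates.\<close>

lemma expectation_indep_sum_sq:
  fixes X :: "'i \<Rightarrow> 'a \<Rightarrow> real"
  assumes ind: "indep_vars (\<lambda>_. borel) X UNIV"
    and sq: "\<And>i. integrable M (\<lambda>\<omega>. (X i \<omega>)\<^sup>2)" and mean: "\<And>i. expectation (X i) = 0"
  shows "expectation (\<lambda>\<omega>. (\<Sum>i\<in>A. X i \<omega>)\<^sup>2) = (\<Sum>i\<in>A. expectation (\<lambda>\<omega>. (X i \<omega>)\<^sup>2))"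
proof (induction A rule: infinite_finite_induct)
  case (insert a A)
  have Xm[measurable]: "X i \<in> borel_measurable M" for i
    using ind unfolding indep_vars_def by blast
  have X1: "integrable M (X i)" for i
    by (rule square_integrable_imp_integrable[OF _ sq]) simp
  have XX: "integrable M (\<lambda>\<omega>. X i \<omega> * X j \<omega>)" for i j
    by (rule integrable_mult_of_squares[OF _ _ sq sq]) auto
  have cross: "expectation (\<lambda>\<omega>. X a \<omega> * X i \<omega>) = 0" if "i \<in> A" for i
  proof -
    have "indep_var (PiM {a} (\<lambda>_. borel)) (\<lambda>\<omega>. restrict (\<lambda>i. X i \<omega>) {a})
        (PiM {i} (\<lambda>_. borel)) (\<lambda>\<omega>. restrict (\<lambda>i. X i \<omega>) {i})"
      using that insert.hyps by (intro indep_var_restrict[OF ind]) auto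
    then have "indep_var borel ((\<lambda>y. y a) \<circ> (\<lambda>\<omega>. restrict (\<lambda>i. X i \<omega>) {a}))
        borel ((\<lambda>y. y i) \<circ> (\<lambda>\<omega>. restrict (\<lambda>i. X i \<omega>) {i}))"
      by (rule indep_var_compose) simp_all
    then have "indep_var borel (X a) borel (X i)" by (simp add: comp_def)
    from indep_var_lebesgue_integral[OF this X1 X1] show ?thesis by (simp add: mean)
  qed
  have S2: "integrable M (\<lambda>\<omega>. (\<Sum>i\<in>A. X i \<omega>)\<^sup>2)"
    by (intro integrable_sum_square sq) simp
  have XS: "integrable M (\<lambda>\<omega>. X a \<omega> * (\<Sum>i\<in>A. X i \<omega>))"
    by (simp add: sum_distrib_left XX)
  have "expectation (\<lambda>\<omega>. X a \<omega> * (\<Sum>i\<in>A. X i \<omega>)) = 0"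
    by (simp add: sum_distrib_left Bochner_Integration.integral_sum XX cross)
  moreover have "expectation (\<lambda>\<omega>. (\<Sum>i\<in>insert a A. X i \<omega>)\<^sup>2)
      = expectation (\<lambda>\<omega>. (X a \<omega>)\<^sup>2 + (\<Sum>i\<in>A. X i \<omega>)\<^sup>2 + 2 * (X a \<omega> * (\<Sum>i\<in>A. X i \<omega>)))"
    using insert.hyps by (simp add: power2_sum mult.assoc)
  moreover have "\<dots> = expectation (\<lambda>\<omega>. (X a \<omega>)\<^sup>2) + expectation (\<lambda>\<omega>. (\<Sum>i\<in>A. X i \<omega>)\<^sup>2)
      + 2 * expectation (\<lambda>\<omega>. X a \<omega> * (\<Sum>i\<in>A. X i \<omega>))"
    using S2 XS sq by simp
  ultimately show ?case using insert by simp
qed auto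

context
  fixes X :: "nat \<Rightarrow> 'a \<Rightarrow> real"
  assumes ind: "indep_vars (\<lambda>_. borel) X UNIV"
    and sq: "\<And>k. integrable M (\<lambda>\<omega>. (X k \<omega>)\<^sup>2)"
    and mean: "\<And>k. expectation (X k) = 0"
begin

lemma indep_X_measurable: "X k \<in> borel_measurable M"
  using ind by (simp add: indep_vars_def)

lemma indep_X_integrable: "integrable M (X k)"
  by (rule square_integrable_imp_integrable[OF indep_X_measurable sq])

lemma indep_sum_sq_integrable: "integrable M (\<lambda>\<omega>. (\<Sum>j\<in>A. X j \<omega>)\<^sup>2)"
  by (intro integrable_sum_square sq indep_X_measurable)

text \<open>The square of the last partial sum is compared with that of the partial sum at the first
  exceedance of \<open>\<epsilon>\<close>; the mixed term vanishes because the first exceedance is determined by the past.\<close>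
lemma Kolmogorov_maximal_inequality:
  assumes "0 < \<epsilon>"
  shows "\<epsilon>\<^sup>2 * prob {\<omega>\<in>space M. \<exists>k\<le>n. \<epsilon> \<le> \<bar>\<Sum>j=m..<m+k. X j \<omega>\<bar>}
    \<le> (\<Sum>j=m..<m+n. expectation (\<lambda>\<omega>. (X j \<omega>)\<^sup>2))"
proof -
  note [measurable] = indep_X_measurable
  define S where "S k \<omega> = (\<Sum>j=m..<m+k. X j \<omega>)" for k \<omega>
  define P where "P k \<omega> \<longleftrightarrow> \<epsilon> \<le> \<bar>S k \<omega>\<bar> \<and> (\<forall>l<k. \<bar>S l \<omega>\<bar> < \<epsilon>)" for k \<omega>
  define U where "U = {\<omega>\<in>space M. \<exists>k\<le>n. \<epsilon> \<le> \<bar>S k \<omega>\<bar>}"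
  define H where "H k \<omega> = (if P k \<omega> then S k \<omega> else 0)" for k \<omega>
  have [measurable]: "S k \<in> borel_measurable M" for k unfolding S_def by measurable
  have [measurable]: "Measurable.pred M (P k)" for k unfolding P_def by measurable
  have [measurable]: "U \<in> sets M" unfolding U_def by measurable
  have [measurable]: "H k \<in> borel_measurable M" for k unfolding H_def by measurable
  have S2: "integrable M (\<lambda>\<omega>. (S k \<omega>)\<^sup>2)" for k unfolding S_def by (rule indep_sum_sq_integrable)
  have H2: "integrable M (\<lambda>\<omega>. (H k \<omega>)\<^sup>2)" for k
    by (rule Bochner_Integration.integrable_bound[OF S2[of k]]) (auto simp: H_def)
  have H1: "integrable M (H k)" for k
    by (rule square_integrable_imp_integrable[OF _ H2]) simp
  have HX: "integrable M (\<lambda>\<omega>. H k \<omega> * X j \<omega>)" for k j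
    by (rule integrable_mult_of_squares[OF _ _ H2 sq]) auto
  have orth: "expectation (\<lambda>\<omega>. H k \<omega> * X j \<omega>) = 0" if "m + k \<le> j" for k j
  proof -
    \<comment> \<open>\<open>H k\<close> rewritten as a function of the first \<open>m+k\<close>
      coordinates alone, the form in which \<open>indep_orthogonal_past\<close> separates it from
      \<open>X j\<close>.\<close>
    define G where "G y = (if \<epsilon> \<le> \<bar>\<Sum>j=m..<m+k. y j\<bar> \<and> (\<forall>l<k. \<bar>\<Sum>j=m..<m+l. y j\<bar> < \<epsilon>)
        then (\<Sum>j=m..<m+k. y j) else 0)" for y :: "nat \<Rightarrow> real"
    have HG: "H k \<omega> = G (restrict (\<lambda>i. X i \<omega>) {..<m+k})" for \<omega>
    proof -
      have "(\<Sum>j=m..<m+l. restrict (\<lambda>i. X i \<omega>) {..<m+k} j) = S l \<omega>" if "l \<le> k" for l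
        using that by (auto simp: S_def intro!: sum.cong)
      then show ?thesis by (auto simp: H_def P_def G_def)
    qed
    have sm: "(\<lambda>y::nat \<Rightarrow> real. \<Sum>j=m..<m+l. y j) \<in> borel_measurable (PiM {..<m+k} (\<lambda>_. borel))"
      if "l \<le> k" for l
      using that by (intro borel_measurable_sum measurable_component_singleton) auto
    have "Measurable.pred (PiM {..<m+k} (\<lambda>_. borel))
        (\<lambda>y::nat \<Rightarrow> real. \<forall>l\<in>{..<k}. \<bar>\<Sum>j=m..<m+l. y j\<bar> < \<epsilon>)"
      by (intro pred_intros_finite borel_measurable_pred_less borel_measurable_abs sm) auto
    then have "G \<in> borel_measurable (PiM {..<m+k} (\<lambda>_. borel))"
      unfolding G_def using sm[OF order_refl]
      by (intro measurable_If pred_intros_logic(5) borel_measurable_pred_less) (auto simp: Ball_def)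
    moreover have "integrable M (\<lambda>\<omega>. G (restrict (\<lambda>i. X i \<omega>) {..<m+k}))"
      unfolding HG[symmetric] by (rule H1)
    ultimately show ?thesis
      unfolding HG by (intro indep_orthogonal_past[OF ind indep_X_integrable mean _ _ that])
  qed
  have diff: "S n \<omega> - S k \<omega> = (\<Sum>j=m+k..<m+n. X j \<omega>)" if "k \<le> n" for k \<omega>
    using sum.atLeastLessThan_concat[of m "m+k" "m+n" "\<lambda>j. X j \<omega>"] that by (simp add: S_def)
  \<comment> \<open>With \<open>k\<close> the first exceedance, only the term \<open>H k\<close>
    survives in the double sum. The claim is the expansion of \<open>(S k + (S n - S k))^2\<close>
    with the last square dropped and the first bounded below by \<open>\<epsilon>^2\<close>.\<close>
  have pw: "\<epsilon>\<^sup>2 * indicator U \<omega> + 2 * (\<Sum>k\<le>n. \<Sum>j=m+k..<m+n. H k \<omega> * X j \<omega>) \<le> (S n \<omega>)\<^sup>2"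
    if "\<omega> \<in> space M" for \<omega>
  proof (cases "\<exists>k\<le>n. \<epsilon> \<le> \<bar>S k \<omega>\<bar>")
    case True
    define k where "k = (LEAST k. \<epsilon> \<le> \<bar>S k \<omega>\<bar>)"
    have k: "\<epsilon> \<le> \<bar>S k \<omega>\<bar>" "k \<le> n"
      using True unfolding k_def by (meson LeastI, meson Least_le order_trans)
    have small: "\<bar>S l \<omega>\<bar> < \<epsilon>" if "l < k" for l
      using not_less_Least[OF that[unfolded k_def]] by simp
    have Peq: "P l \<omega> \<longleftrightarrow> l = k" for l
      using k small unfolding P_def by (metis linorder_neqE_nat not_less)
    have "(\<Sum>l\<le>n. \<Sum>j=m+l..<m+n. H l \<omega> * X j \<omega>) = (\<Sum>l\<le>n. if l = k then S k \<omega> * (S n \<omega> - S k \<omega>) else 0)"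
      by (intro sum.cong) (auto simp: H_def Peq diff sum_distrib_left)
    also have "\<dots> = S k \<omega> * (S n \<omega> - S k \<omega>)" using k by simp
    finally have eq: "(\<Sum>l\<le>n. \<Sum>j=m+l..<m+n. H l \<omega> * X j \<omega>) = S k \<omega> * (S n \<omega> - S k \<omega>)" .
    have "\<epsilon>\<^sup>2 \<le> (S k \<omega>)\<^sup>2"
      using k(1) \<open>0 < \<epsilon>\<close> by (metis less_imp_le power2_abs power_mono)
    moreover have "(S k \<omega>)\<^sup>2 + 2 * (S k \<omega> * (S n \<omega> - S k \<omega>)) + (S n \<omega> - S k \<omega>)\<^sup>2 = (S n \<omega>)\<^sup>2"
      by (simp add: power2_eq_square algebra_simps)
    moreover have "\<epsilon>\<^sup>2 * indicator U \<omega> \<le> \<epsilon>\<^sup>2" by (simp add: indicator_def)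
    moreover have "0 \<le> (S n \<omega> - S k \<omega>)\<^sup>2" by simp
    ultimately show ?thesis unfolding eq by linarith
  next
    case False
    then have "H l \<omega> = 0" if "l \<le> n" for l using that by (auto simp: H_def P_def)
    moreover have "\<omega> \<notin> U" using False by (auto simp: U_def)
    ultimately show ?thesis by simp
  qed
  have U_int: "integrable M (indicator U :: 'a \<Rightarrow> real)"
    by (intro integrable_real_indicator) (auto simp: emeasure_eq_measure)
  have HX_sum: "integrable M (\<lambda>\<omega>. \<Sum>k\<le>n. \<Sum>j=m+k..<m+n. H k \<omega> * X j \<omega>)"
    by (intro Bochner_Integration.integrable_sum HX)
  have "expectation (\<lambda>\<omega>. \<Sum>k\<le>n. \<Sum>j=m+k..<m+n. H k \<omega> * X j \<omega>)
      = (\<Sum>k\<le>n. \<Sum>j=m+k..<m+n. expectation (\<lambda>\<omega>. H k \<omega> * X j \<omega>))"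
    by (subst Bochner_Integration.integral_sum)
      (auto intro!: sum.cong Bochner_Integration.integral_sum Bochner_Integration.integrable_sum HX)
  also have "\<dots> = 0" using orth by (intro sum.neutral ballI) auto
  finally have HX_0: "expectation (\<lambda>\<omega>. \<Sum>k\<le>n. \<Sum>j=m+k..<m+n. H k \<omega> * X j \<omega>) = 0" .
  have "\<epsilon>\<^sup>2 * prob U
      = expectation (\<lambda>\<omega>. \<epsilon>\<^sup>2 * indicator U \<omega> + 2 * (\<Sum>k\<le>n. \<Sum>j=m+k..<m+n. H k \<omega> * X j \<omega>))"
    using HX_sum HX_0 U_int by (subst Bochner_Integration.integral_add) auto
  also have "\<dots> \<le> expectation (\<lambda>\<omega>. (S n \<omega>)\<^sup>2)"
    using HX_sum S2 pw U_int by (intro integral_mono) auto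
  also have "\<dots> = (\<Sum>j=m..<m+n. expectation (\<lambda>\<omega>. (X j \<omega>)\<^sup>2))"
    unfolding S_def by (rule expectation_indep_sum_sq[OF ind sq mean])
  finally show ?thesis by (simp add: U_def S_def)
qed

section \<open>Almost sure convergence of the series and second moments of its tails\<close>

context
  assumes summ: "summable (\<lambda>k. expectation (\<lambda>\<omega>. (X k \<omega>)\<^sup>2))"
begin

lemma expectation_sum_sq_le_tail:
  "(\<Sum>j=m..<m+n. expectation (\<lambda>\<omega>. (X j \<omega>)\<^sup>2)) \<le> (\<Sum>k. expectation (\<lambda>\<omega>. (X (k + m) \<omega>)\<^sup>2))"
proof -
  have "(\<Sum>j=m..<m+n. expectation (\<lambda>\<omega>. (X j \<omega>)\<^sup>2)) = (\<Sum>k<n. expectation (\<lambda>\<omega>. (X (k + m) \<omega>)\<^sup>2))"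
    by (rule sum.reindex_bij_witness[of _ "\<lambda>k. k + m" "\<lambda>j. j - m"]) auto
  also have "\<dots> \<le> (\<Sum>k. expectation (\<lambda>\<omega>. (X (k + m) \<omega>)\<^sup>2))"
    using summ by (intro sum_le_suminf) (auto simp: summable_iff_shift[of "\<lambda>k. expectation (\<lambda>\<omega>. (X k \<omega>)\<^sup>2)"])
  finally show ?thesis .
qed

text \<open>\<open>N m e\<close> is the event that some block starting at \<open>m\<close> reaches
  size \<open>e\<close>. Its probability is at most a tail of the convergent series of variances
  over \<open>e^2\<close>, so almost surely, for each of countably many \<open>e\<close>, some
  \<open>m\<close> escapes it, and this is the Cauchy criterion.\<close>

lemma AE_summable_indep: "AE \<omega> in M. summable (\<lambda>k. X k \<omega>)"
proof -
  note [measurable] = indep_X_measurable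
  define r where "r m = (\<Sum>k. expectation (\<lambda>\<omega>. (X (k + m) \<omega>)\<^sup>2))" for m
  have r0: "r \<longlonglongrightarrow> 0"
    unfolding r_def by (rule suminf_exist_split2[OF summ])
  define N where "N m e = {\<omega>\<in>space M. \<exists>k. e \<le> \<bar>\<Sum>j=m..<m+k. X j \<omega>\<bar>}" for m and e :: real
  have [measurable]: "N m e \<in> sets M" for m e unfolding N_def by measurable
  \<comment> \<open>The maximal inequality bounds blocks of length at most \<open>n\<close> by a
    quantity free of \<open>n\<close>, so the bound passes to the increasing union over
    \<open>n\<close>.\<close>
  have N_le: "prob (N m e) \<le> r m / e\<^sup>2" if "0 < e" for m e
  proof -
    define A where "A n = {\<omega>\<in>space M. \<exists>k\<le>n. e \<le> \<bar>\<Sum>j=m..<m+k. X j \<omega>\<bar>}" for n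
    have "(\<lambda>n. prob (A n)) \<longlonglongrightarrow> prob (\<Union>n. A n)"
      by (rule finite_Lim_measure_incseq)
        (auto simp: A_def incseq_def intro: order_trans)
    moreover have "(\<Union>n. A n) = N m e" by (auto simp: A_def N_def)
    moreover have "prob (A n) \<le> r m / e\<^sup>2" for n
    proof -
      have "e\<^sup>2 * prob (A n) \<le> r m"
        unfolding A_def r_def
        by (rule order_trans[OF Kolmogorov_maximal_inequality[OF that] expectation_sum_sq_le_tail])
      then show ?thesis using that by (simp add: field_simps)
    qed
    ultimately show ?thesis by (metis LIMSEQ_le_const2)
  qed
  have "AE \<omega> in M. \<exists>m. \<omega> \<notin> N m e" if "0 < e" for e
  proof -
    have "prob (\<Inter>m. N m e) \<le> r m / e\<^sup>2" for m
      by (rule order_trans[OF finite_measure_mono N_le[OF that]]) auto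
    moreover have "(\<lambda>m. r m / e\<^sup>2) \<longlonglongrightarrow> 0" using r0 by (auto intro: tendsto_divide_zero)
    ultimately have "prob (\<Inter>m. N m e) \<le> 0" by (metis LIMSEQ_le_const)
    then have "emeasure M (\<Inter>m. N m e) = 0"
      by (simp add: emeasure_eq_measure measure_le_0_iff)
    then have "AE \<omega> in M. \<omega> \<notin> (\<Inter>m. N m e)"
      by (intro AE_not_in) (auto simp: null_sets_def)
    then show ?thesis by (auto elim!: eventually_mono)
  qed
  then have "AE \<omega> in M. \<forall>q. \<exists>m. \<omega> \<notin> N m (inverse (real (Suc q)))"
    unfolding AE_all_countable by simp
  then show ?thesis
  proof (rule AE_mp[OF _ AE_I2], intro impI)
    fix \<omega> assume \<omega>: "\<omega> \<in> space M" and *: "\<forall>q. \<exists>m. \<omega> \<notin> N m (inverse (real (Suc q)))"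
    show "summable (\<lambda>k. X k \<omega>)"
      unfolding summable_Cauchy
    proof (intro allI impI)
      fix e :: real assume "0 < e"
      \<comment> \<open>Half of \<open>e\<close>, because a block \<open>m..<n\<close> is the
        difference of two blocks that both start at \<open>M0\<close>.\<close>
      then obtain q where q: "inverse (real (Suc q)) < e / 2" using reals_Archimedean[of "e/2"] by auto
      obtain M0 where M0: "\<omega> \<notin> N M0 (inverse (real (Suc q)))" using * by blast
      have b: "\<bar>\<Sum>j=M0..<n. X j \<omega>\<bar> < e / 2" if "M0 \<le> n" for n
        using M0 \<omega> that q unfolding N_def
        by (auto simp: not_le dest!: spec[of _ "n - M0"])
      have "norm (sum (\<lambda>k. X k \<omega>) {m..<n}) < e" if "M0 \<le> m" for m n
      proof (cases "m \<le> n")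
        case True
        have "sum (\<lambda>k. X k \<omega>) {m..<n} = (\<Sum>j=M0..<n. X j \<omega>) - (\<Sum>j=M0..<m. X j \<omega>)"
          using sum.atLeastLessThan_concat[of M0 m n "\<lambda>k. X k \<omega>"] that True by simp
        then show ?thesis using b[of m] b[of n] that True by auto
      qed (use \<open>0 < e\<close> in simp)
      then show "\<exists>N. \<forall>m\<ge>N. \<forall>n. norm (sum (\<lambda>k. X k \<omega>) {m..<n}) < e" by blast
    qed
  qed
qed

text \<open>Fatou along the finite blocks \<open>n..<n+k\<close> as \<open>k\<close> grows. Only an
  upper bound results; the lower bound on variances comes later, from invariance.\<close>

lemma indep_series_tail_sq:
  "integrable M (\<lambda>\<omega>. ((\<Sum>k. X k \<omega>) - (\<Sum>k<n. X k \<omega>))\<^sup>2)" (is ?int)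
  "expectation (\<lambda>\<omega>. ((\<Sum>k. X k \<omega>) - (\<Sum>k<n. X k \<omega>))\<^sup>2)
    \<le> (\<Sum>k. expectation (\<lambda>\<omega>. (X (k + n) \<omega>)\<^sup>2))" (is ?le)
proof -
  note [measurable] = indep_X_measurable
  have *: "AE \<omega> in M. (\<lambda>k. (\<Sum>j=n..<n+k. X j \<omega>)\<^sup>2) \<longlonglongrightarrow> ((\<Sum>k. X k \<omega>) - (\<Sum>k<n. X k \<omega>))\<^sup>2"
    using AE_summable_indep
  proof (rule eventually_mono)
    fix \<omega> assume "summable (\<lambda>k. X k \<omega>)"
    then have "(\<lambda>k. (\<Sum>j<n+k. X j \<omega>)) \<longlonglongrightarrow> (\<Sum>k. X k \<omega>)"
      using LIMSEQ_ignore_initial_segment[OF summable_LIMSEQ, of "\<lambda>k. X k \<omega>" n] by (simp add: add.commute)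
    then have "(\<lambda>k. ((\<Sum>j<n+k. X j \<omega>) - (\<Sum>k<n. X k \<omega>))\<^sup>2) \<longlonglongrightarrow> ((\<Sum>k. X k \<omega>) - (\<Sum>k<n. X k \<omega>))\<^sup>2"
      by (intro tendsto_intros)
    moreover have "(\<Sum>j<n+k. X j \<omega>) - (\<Sum>k<n. X k \<omega>) = (\<Sum>j=n..<n+k. X j \<omega>)" for k
      using sum.atLeastLessThan_concat[of 0 n "n+k" "\<lambda>j. X j \<omega>"] by (simp add: lessThan_atLeast0)
    ultimately show "(\<lambda>k. (\<Sum>j=n..<n+k. X j \<omega>)\<^sup>2) \<longlonglongrightarrow> ((\<Sum>k. X k \<omega>) - (\<Sum>k<n. X k \<omega>))\<^sup>2"
      by simp
  qed
  note F = integral_Fatou_bound[OF _ _ indep_sum_sq_integrable _ _ *,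
      of "\<Sum>k. expectation (\<lambda>\<omega>. (X (k + n) \<omega>)\<^sup>2)"]
  show ?int ?le
    by (rule F; simp add: expectation_indep_sum_sq[OF ind sq mean] expectation_sum_sq_le_tail)+
qed

end
end
end

section \<open>Laws on real-valued product spaces\<close>

text \<open>Lower orthants in finitely many coordinates are chosen as generator because they are
  closed under intersection and their indicators are limits of products of Lipschitz
  functions.\<close>

lemma sets_PiM_UNIV_borel_lower:
  "sets (PiM UNIV (\<lambda>_::'i. borel :: real measure)) =
    sigma_sets UNIV {{\<eta>. \<forall>j\<in>J. \<eta> j \<le> a j} | J a. finite J}" (is "_ = sigma_sets UNIV ?E")
proof
  have "(\<lambda>\<eta>. \<eta>) \<in> measurable (sigma UNIV ?E) (PiM UNIV (\<lambda>_::'i. borel :: real measure))"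
  proof (rule measurable_PiM_single')
    fix i :: 'i
    show "(\<lambda>\<eta>. \<eta> i) \<in> borel_measurable (sigma UNIV ?E)"
    proof (rule borel_measurableI_le)
      fix y :: real
      have "{\<eta>. \<eta> i \<le> y} = {\<eta>. \<forall>j\<in>{i}. \<eta> j \<le> (\<lambda>_. y) j}" by auto
      then have "{\<eta>. \<eta> i \<le> y} \<in> ?E"
        by (intro CollectI exI[of _ "{i}"] exI[of _ "\<lambda>_. y"]) simp
      then show "{\<eta> \<in> space (sigma UNIV ?E). \<eta> i \<le> y} \<in> sets (sigma UNIV ?E)"
        by (auto simp: space_measure_of_conv)
    qed
  qed (auto simp: PiE_def)
  then show "sets (PiM UNIV (\<lambda>_::'i. borel :: real measure)) \<subseteq> sigma_sets UNIV ?E"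
    using measurable_sets[of "\<lambda>\<eta>. \<eta>" "sigma UNIV ?E"] by (auto simp: space_PiM)
  have "{\<eta>\<in>space (PiM UNIV (\<lambda>_::'i. borel)). \<forall>j\<in>J. \<eta> j \<le> a j} \<in> sets (PiM UNIV (\<lambda>_::'i. borel :: real measure))"
    if "finite J" for J a
    using that by measurable
  then have "?E \<subseteq> sets (PiM UNIV (\<lambda>_::'i. borel :: real measure))"
    by (auto simp: space_PiM)
  then show "sigma_sets UNIV ?E \<subseteq> sets (PiM UNIV (\<lambda>_::'i. borel :: real measure))"
    using sets.sigma_sets_subset[of ?E "PiM UNIV (\<lambda>_::'i. borel :: real measure)"] by (simp add: space_PiM)
qed

lemma measure_eqI_PiM_borel_lower:
  assumes P: "prob_space P" "sets P = sets (PiM UNIV (\<lambda>_::'i. borel :: real measure))"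
    and Q: "prob_space Q" "sets Q = sets (PiM UNIV (\<lambda>_::'i. borel :: real measure))"
    and eq: "\<And>J a. finite J \<Longrightarrow> measure P {\<eta>. \<forall>j\<in>J. \<eta> j \<le> a j} = measure Q {\<eta>. \<forall>j\<in>J. \<eta> j \<le> a j}"
  shows "P = Q"
proof (rule measure_eqI_generator_eq)
  interpret P: prob_space P by fact
  interpret Q: prob_space Q by fact
  let ?E = "{{\<eta> :: 'i \<Rightarrow> real. \<forall>j\<in>J. \<eta> j \<le> a j} | J a. finite J}"
  show "Int_stable ?E"
  proof (rule Int_stableI)
    fix A B assume "A \<in> ?E" "B \<in> ?E"
    then obtain J a K b where *: "finite J" "finite K" "A = {\<eta>. \<forall>j\<in>J. \<eta> j \<le> a j}"
      "B = {\<eta>. \<forall>j\<in>K. \<eta> j \<le> b j}" by blast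
    define c where "c j = (if j \<in> J then if j \<in> K then min (a j) (b j) else a j else b j)" for j
    have "A \<inter> B = {\<eta>. \<forall>j\<in>J \<union> K. \<eta> j \<le> c j}"
      unfolding * by (auto simp: c_def split: if_splits)
    with * show "A \<inter> B \<in> ?E" by blast
  qed
  show "sets P = sigma_sets UNIV ?E" "sets Q = sigma_sets UNIV ?E"
    using P(2) Q(2) sets_PiM_UNIV_borel_lower by simp_all
  show "emeasure P X = emeasure Q X" if "X \<in> ?E" for X
    using that eq by (auto simp: P.emeasure_eq_measure Q.emeasure_eq_measure)
  have "{\<eta> :: 'i \<Rightarrow> real. \<forall>j\<in>{}. \<eta> j \<le> (\<lambda>_. 0) j} \<in> ?E" by blast
  then show "range (\<lambda>_::nat. UNIV) \<subseteq> ?E" by auto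
  show "emeasure P UNIV \<noteq> \<infinity>" by (simp add: P.emeasure_eq_measure)
qed auto

section \<open>Identification of a law by Lipschitz test functions\<close>

text \<open>A majorant of the indicator of \<open>t \<le> a\<close> with Lipschitz constant
  \<open>m\<close>; for positive \<open>m\<close> it vanishes from \<open>a + 1/m\<close>
  on.\<close>

definition ramp :: "nat \<Rightarrow> real \<Rightarrow> real \<Rightarrow> real" where
  "ramp m a t = max 0 (1 - real m * max 0 (t - a))"

lemma ramp_bounds: "0 \<le> ramp m a t" "ramp m a t \<le> 1"
  by (auto simp: ramp_def)

lemma ramp_lipschitz: "\<bar>ramp m a s - ramp m a t\<bar> \<le> real m * \<bar>s - t\<bar>"
proof -
  have "\<bar>ramp m a s - ramp m a t\<bar> \<le> \<bar>real m * max 0 (s - a) - real m * max 0 (t - a)\<bar>"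
    unfolding ramp_def by linarith
  also have "\<dots> = real m * \<bar>max 0 (s - a) - max 0 (t - a)\<bar>"
    by (simp add: abs_mult right_diff_distrib[symmetric])
  also have "\<dots> \<le> real m * \<bar>s - t\<bar>"
    by (intro mult_left_mono) auto
  finally show ?thesis .
qed

lemma ramp_tendsto: "(\<lambda>m. ramp m a t) \<longlonglongrightarrow> (if t \<le> a then 1 else 0)"
proof (cases "t \<le> a")
  case False
  then obtain N where N: "1 < real N * (t - a)"
    using ex_less_of_nat_mult[of "t - a" 1] by auto
  have "ramp m a t = 0" if "N \<le> m" for m
  proof -
    have "real N * (t - a) \<le> real m * (t - a)"
      using that False by (intro mult_right_mono) auto
    moreover have "max 0 (t - a) = t - a" using False by simp
    ultimately have "1 < real m * max 0 (t - a)" using N by linarith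
    then show ?thesis by (simp add: ramp_def)
  qed
  then have "eventually (\<lambda>m. ramp m a t = 0) sequentially"
    using eventually_sequentially by blast
  then show ?thesis using False by (simp add: tendsto_eventually)
qed (simp add: ramp_def)

lemma ramp_measurable[measurable]: "ramp m a \<in> borel_measurable borel"
  unfolding ramp_def by measurable

lemma integral_prod_ramp_tendsto:
  assumes P: "prob_space P" and sets: "sets P = sets (PiM UNIV (\<lambda>_::'i. borel :: real measure))"
    and J: "finite J"
  shows "(\<lambda>m. \<integral>\<eta>. (\<Prod>j\<in>J. ramp m (a j) (\<eta> j)) \<partial>P) \<longlonglongrightarrow> measure P {\<eta>. \<forall>j\<in>J. \<eta> j \<le> a j}"
proof -
  interpret P: prob_space P by fact
  have sp: "space P = UNIV" using sets_eq_imp_space_eq[OF sets] by (simp add: space_PiM)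
  have rm: "(\<lambda>\<eta>. \<Prod>j\<in>J. ramp m (a j) (\<eta> j)) \<in> borel_measurable P" for m
    unfolding measurable_cong_sets[OF sets refl] by measurable
  have S[measurable]: "{\<eta>. \<forall>j\<in>J. \<eta> j \<le> a j} \<in> sets P"
    unfolding sets sets_PiM_UNIV_borel_lower using J by (intro sigma_sets.Basic) blast
  have "(\<lambda>m. \<integral>\<eta>. (\<Prod>j\<in>J. ramp m (a j) (\<eta> j)) \<partial>P)
      \<longlonglongrightarrow> (\<integral>\<eta>. indicator {\<eta>. \<forall>j\<in>J. \<eta> j \<le> a j} \<eta> \<partial>P)"
  proof (rule integral_dominated_convergence[where w="\<lambda>_. 1"])
    show "AE \<eta> in P. (\<lambda>m. \<Prod>j\<in>J. ramp m (a j) (\<eta> j)) \<longlonglongrightarrow> indicator {\<eta>. \<forall>j\<in>J. \<eta> j \<le> a j} \<eta>"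
    proof (rule AE_I2)
      fix \<eta> :: "'i \<Rightarrow> real"
      have "(\<lambda>m. \<Prod>j\<in>J. ramp m (a j) (\<eta> j)) \<longlonglongrightarrow> (\<Prod>j\<in>J. if \<eta> j \<le> a j then 1 else 0)"
        by (intro tendsto_prod ramp_tendsto)
      also have "(\<Prod>j\<in>J. if \<eta> j \<le> a j then 1 else 0) = (indicator {\<eta>. \<forall>j\<in>J. \<eta> j \<le> a j} \<eta> :: real)"
        using J by (auto simp: indicator_def)
      finally show "(\<lambda>m. \<Prod>j\<in>J. ramp m (a j) (\<eta> j)) \<longlonglongrightarrow> indicator {\<eta>. \<forall>j\<in>J. \<eta> j \<le> a j} \<eta>" .
    qed
    show "AE \<eta> in P. norm (\<Prod>j\<in>J. ramp m (a j) (\<eta> j)) \<le> 1" for m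
      by (simp add: abs_prod ramp_bounds prod_le_1 abs_of_nonneg)
  qed (use S rm in \<open>simp_all\<close>)
  then show ?thesis using sp by simp
qed

text \<open>For a fixed ramp parameter \<open>m\<close>, the integral of a product of ramps against
  the common law differs from that against the law of \<open>R\<close> by at most \<open>m\<close>
  times a finite sum of L^1 distances. First \<open>n\<close> tends to infinity, which makes the
  integrals equal; then \<open>m\<close> does, which turns ramps into orthants.\<close>

lemma distr_PiM_eq_of_L1_limit:
  fixes R :: "'a \<Rightarrow> 'i \<Rightarrow> real" and Rn :: "nat \<Rightarrow> 'a \<Rightarrow> 'i \<Rightarrow> real"
  defines "B \<equiv> PiM UNIV (\<lambda>_::'i. borel :: real measure)"
  assumes Q: "prob_space Q"
    and Rn[measurable]: "\<And>n. Rn n \<in> measurable Q B" and R[measurable]: "R \<in> measurable Q B"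
    and law: "\<And>n. distr Q B (Rn n) = \<nu>"
    and int: "\<And>n j. integrable Q (\<lambda>\<omega>. Rn n \<omega> j - R \<omega> j)"
    and lim: "\<And>j. (\<lambda>n. \<integral>\<omega>. \<bar>Rn n \<omega> j - R \<omega> j\<bar> \<partial>Q) \<longlonglongrightarrow> 0"
  shows "distr Q B R = \<nu>"
proof (rule measure_eqI_PiM_borel_lower)
  interpret Q: prob_space Q by fact
  show PR: "prob_space (distr Q B R)" and P\<nu>: "prob_space \<nu>"
    using Q.prob_space_distr[OF R] Q.prob_space_distr[OF Rn] law by auto
  show SR: "sets (distr Q B R) = sets (PiM UNIV (\<lambda>_::'i. borel))"
    and S\<nu>: "sets \<nu> = sets (PiM UNIV (\<lambda>_::'i. borel))"
    unfolding law[of 0, symmetric] by (simp_all add: B_def)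
  fix J :: "'i set" and a assume J: "finite J"
  have comp[measurable]: "(\<lambda>\<eta>. \<eta> j) \<in> borel_measurable B" for j unfolding B_def by simp
  define f where "f m \<eta> = (\<Prod>j\<in>J. ramp m (a j) (\<eta> j))" for m and \<eta> :: "'i \<Rightarrow> real"
  have f[measurable]: "f m \<in> borel_measurable B" for m unfolding f_def by measurable
  have fb: "norm (f m \<eta>) \<le> 1" for m \<eta>
    by (simp add: f_def abs_prod ramp_bounds prod_le_1 abs_of_nonneg)
  have fi: "integrable Q (\<lambda>\<omega>. f m (S \<omega>))" if [measurable]: "S \<in> measurable Q B" for m S
    by (rule Q.integrable_const_bound[where B=1]) (use fb in auto)
  have eq: "(\<integral>\<eta>. f m \<eta> \<partial>distr Q B R) = (\<integral>\<eta>. f m \<eta> \<partial>\<nu>)" for m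
  proof -
    have "\<bar>(\<integral>\<eta>. f m \<eta> \<partial>\<nu>) - (\<integral>\<eta>. f m \<eta> \<partial>distr Q B R)\<bar>
        \<le> (\<Sum>j\<in>J. real m * (\<integral>\<omega>. \<bar>Rn n \<omega> j - R \<omega> j\<bar> \<partial>Q))" for n
    proof -
      have "(\<integral>\<eta>. f m \<eta> \<partial>\<nu>) - (\<integral>\<eta>. f m \<eta> \<partial>distr Q B R) = (\<integral>\<omega>. f m (Rn n \<omega>) - f m (R \<omega>) \<partial>Q)"
        unfolding law[of n, symmetric] by (simp add: integral_distr fi)
      also have "\<bar>\<dots>\<bar> \<le> (\<integral>\<omega>. \<bar>f m (Rn n \<omega>) - f m (R \<omega>)\<bar> \<partial>Q)"
        using integral_abs_bound by blast
      also have "\<dots> \<le> (\<integral>\<omega>. (\<Sum>j\<in>J. real m * \<bar>Rn n \<omega> j - R \<omega> j\<bar>) \<partial>Q)"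
      proof (rule integral_mono)
        fix \<omega>
        have "norm (f m (Rn n \<omega>) - f m (R \<omega>)) \<le> (\<Sum>j\<in>J. norm (ramp m (a j) (Rn n \<omega> j) - ramp m (a j) (R \<omega> j)))"
          unfolding f_def by (rule norm_prod_diff) (simp_all add: ramp_bounds)
        also have "\<dots> \<le> (\<Sum>j\<in>J. real m * \<bar>Rn n \<omega> j - R \<omega> j\<bar>)"
          by (intro sum_mono) (simp add: ramp_lipschitz)
        finally show "\<bar>f m (Rn n \<omega>) - f m (R \<omega>)\<bar> \<le> (\<Sum>j\<in>J. real m * \<bar>Rn n \<omega> j - R \<omega> j\<bar>)" by simp
      qed (use int fi in auto)
      also have "\<dots> = (\<Sum>j\<in>J. real m * (\<integral>\<omega>. \<bar>Rn n \<omega> j - R \<omega> j\<bar> \<partial>Q))"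
        using int by (subst Bochner_Integration.integral_sum) auto
      finally show ?thesis .
    qed
    moreover have "(\<lambda>n. \<Sum>j\<in>J. real m * (\<integral>\<omega>. \<bar>Rn n \<omega> j - R \<omega> j\<bar> \<partial>Q)) \<longlonglongrightarrow> 0"
      by (intro tendsto_null_sum tendsto_mult_right_zero lim)
    ultimately have "\<bar>(\<integral>\<eta>. f m \<eta> \<partial>\<nu>) - (\<integral>\<eta>. f m \<eta> \<partial>distr Q B R)\<bar> \<le> 0"
      by (intro LIMSEQ_le_const) auto
    then show ?thesis by simp
  qed
  show "measure (distr Q B R) {\<eta>. \<forall>j\<in>J. \<eta> j \<le> a j} = measure \<nu> {\<eta>. \<forall>j\<in>J. \<eta> j \<le> a j}"
    using integral_prod_ramp_tendsto[OF PR SR J, of a] integral_prod_ramp_tendsto[OF P\<nu> S\<nu> J, of a]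
    by (intro LIMSEQ_unique) (auto simp: eq[unfolded f_def])
qed

section \<open>Independent coordinates and the shift of the noise history\<close>

lemma indep_vars_PiM_coords:
  assumes "prob_space \<mu>" and sets: "sets \<mu> = sets borel"
  shows "prob_space.indep_vars (PiM UNIV (\<lambda>_::'i. \<mu>)) (\<lambda>_. borel) (\<lambda>i \<omega>. \<omega> i) UNIV"
proof -
  interpret \<mu>: prob_space \<mu> by fact
  interpret product_prob_space "\<lambda>_::'i. \<mu>" UNIV by unfold_locales
  have "P.indep_vars (\<lambda>_. \<mu>) (\<lambda>i \<omega>. \<omega> i) UNIV"
    by (subst P.indep_vars_iff_distr_eq_PiM) (simp_all add: PiM_component restrict_UNIV)
  then show ?thesis
    by (rule P.indep_vars_compose2[where Y="\<lambda>_ t. t"]) (simp add: measurable_ident_sets[OF sets])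
qed

text \<open>The passage of one time unit: in a history, \<open>(k, z)\<close> carries the noise of
  \<open>k\<close> steps ago, so a fresh field becomes layer \<open>0\<close> and every older layer
  ages by one.\<close>

definition hist_cons :: "(nat \<times> 'z \<Rightarrow> real) \<times> ('z \<Rightarrow> real) \<Rightarrow> nat \<times> 'z \<Rightarrow> real" where
  "hist_cons = (\<lambda>(\<omega>, \<xi>) (k, z). case k of 0 \<Rightarrow> \<xi> z | Suc k' \<Rightarrow> \<omega> (k', z))"

lemma hist_cons_simps[simp]:
  "hist_cons (\<omega>, \<xi>) (0, z) = \<xi> z" "hist_cons (\<omega>, \<xi>) (Suc k, z) = \<omega> (k, z)"
  by (simp_all add: hist_cons_def)

lemma measurable_hist_cons:
  "hist_cons \<in> measurable (PiM UNIV (\<lambda>_::nat \<times> 'z. \<mu>) \<Otimes>\<^sub>M PiM UNIV (\<lambda>_::'z. \<mu>)) (PiM UNIV (\<lambda>_. \<mu>))"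
proof -
  have "(\<lambda>p i. hist_cons p i) \<in> measurable (PiM UNIV (\<lambda>_::nat \<times> 'z. \<mu>) \<Otimes>\<^sub>M PiM UNIV (\<lambda>_::'z. \<mu>)) (PiM UNIV (\<lambda>_. \<mu>))"
  proof (rule measurable_PiM_single')
    fix i :: "nat \<times> 'z"
    show "(\<lambda>p. hist_cons p i) \<in> measurable (PiM UNIV (\<lambda>_::nat \<times> 'z. \<mu>) \<Otimes>\<^sub>M PiM UNIV (\<lambda>_::'z. \<mu>)) \<mu>"
    proof (cases i)
      case (Pair k z)
      show ?thesis unfolding Pair hist_cons_def by (cases k) (simp_all add: split_beta')
    qed
  next
    show "hist_cons \<in> space (PiM UNIV (\<lambda>_::nat \<times> 'z. \<mu>) \<Otimes>\<^sub>M PiM UNIV (\<lambda>_::'z. \<mu>)) \<rightarrow> (\<Pi>\<^sub>E i\<in>UNIV. space \<mu>)"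
      by (auto simp: space_pair_measure space_PiM PiE_iff hist_cons_def split: nat.splits)
  qed
  then show ?thesis by simp
qed

text \<open>A product law is determined by its finite cylinders, and the preimage of a cylinder is a
  rectangle: its conditions split into those on older layers and those on the fresh field.\<close>

lemma distr_hist_cons:
  assumes "prob_space \<mu>"
  shows "distr (PiM UNIV (\<lambda>_::nat \<times> 'z. \<mu>) \<Otimes>\<^sub>M PiM UNIV (\<lambda>_::'z. \<mu>)) (PiM UNIV (\<lambda>_. \<mu>)) hist_cons
    = PiM UNIV (\<lambda>_. \<mu>)"
proof -
  interpret \<mu>: prob_space \<mu> by fact
  interpret H: product_prob_space "\<lambda>_::nat \<times> 'z. \<mu>" UNIV by unfold_locales
  interpret F: product_prob_space "\<lambda>_::'z. \<mu>" UNIV by unfold_locales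
  let ?H = "PiM UNIV (\<lambda>_::nat \<times> 'z. \<mu>)" and ?F = "PiM UNIV (\<lambda>_::'z. \<mu>)"
  show ?thesis
  proof (rule H.PiM_eq)
    fix J and E :: "nat \<times> 'z \<Rightarrow> real set"
    assume J: "finite J" and E: "\<And>j. j \<in> J \<Longrightarrow> E j \<in> sets \<mu>"
    \<comment> \<open>\<open>A\<close> collects the conditions on positive layers, with the time
      index lowered by one; \<open>B\<close> collects those on layer \<open>0\<close>.\<close>
    define A where "A = {(k, z). (Suc k, z) \<in> J}"
    define B where "B = {z. (0, z) \<in> J}"
    have J_eq: "J = (\<lambda>(k, z). (Suc k, z)) ` A \<union> Pair 0 ` B"
    proof (intro equalityI subsetI)
      fix j assume "j \<in> J"
      then show "j \<in> (\<lambda>(k, z). (Suc k, z)) ` A \<union> Pair 0 ` B"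
        by (cases j; cases "fst j") (force simp: A_def B_def)+
    qed (auto simp: A_def B_def)
    have inj: "inj_on (\<lambda>(k, z). (Suc k, z)) A" "inj_on (Pair 0) B"
      by (auto simp: inj_on_def)
    have fin: "finite A" "finite B"
      using J inj by (auto simp: J_eq dest: finite_imageD)
    let ?EA = "prod_emb UNIV (\<lambda>_. \<mu>) A (\<Pi>\<^sub>E (k, z)\<in>A. E (Suc k, z))"
    let ?EB = "prod_emb UNIV (\<lambda>_. \<mu>) B (\<Pi>\<^sub>E z\<in>B. E (0, z))"
    have EA: "E (Suc k, z) \<in> sets \<mu>" if "(k, z) \<in> A" for k z using that E by (auto simp: A_def)
    have EB: "E (0, z) \<in> sets \<mu>" if "z \<in> B" for z using that E by (auto simp: B_def)
    have "hist_cons -` prod_emb UNIV (\<lambda>_. \<mu>) J (Pi\<^sub>E J E) \<inter> space (?H \<Otimes>\<^sub>M ?F) = ?EA \<times> ?EB"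
    proof (intro set_eqI)
      fix x :: "(nat \<times> 'z \<Rightarrow> real) \<times> ('z \<Rightarrow> real)"
      obtain \<omega> \<xi> where x: "x = (\<omega>, \<xi>)" by (cases x)
      have "(\<forall>j\<in>J. hist_cons (\<omega>, \<xi>) j \<in> E j) \<longleftrightarrow>
          (\<forall>(k, z)\<in>A. \<omega> (k, z) \<in> E (Suc k, z)) \<and> (\<forall>z\<in>B. \<xi> z \<in> E (0, z))"
        unfolding J_eq ball_Un Set.ball_simps(9) by (auto simp: split_beta')
      moreover have "(\<forall>j. hist_cons (\<omega>, \<xi>) j \<in> space \<mu>) \<longleftrightarrow> (\<forall>j. \<omega> j \<in> space \<mu>) \<and> (\<forall>z. \<xi> z \<in> space \<mu>)"
      proof
        assume *: "\<forall>j. hist_cons (\<omega>, \<xi>) j \<in> space \<mu>"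
        have "\<omega> (k, z) \<in> space \<mu>" "\<xi> z \<in> space \<mu>" for k z
          using *[rule_format, of "(Suc k, z)"] *[rule_format, of "(0, z)"] by simp_all
        then show "(\<forall>j. \<omega> j \<in> space \<mu>) \<and> (\<forall>z. \<xi> z \<in> space \<mu>)" by auto
      qed (auto simp: hist_cons_def split: nat.split)
      ultimately show "x \<in> hist_cons -` prod_emb UNIV (\<lambda>_. \<mu>) J (Pi\<^sub>E J E) \<inter> space (?H \<Otimes>\<^sub>M ?F)
          \<longleftrightarrow> x \<in> ?EA \<times> ?EB"
        unfolding x by (auto simp: prod_emb_iff space_pair_measure space_PiM PiE_iff split: prod.splits)
    qed
    then have "emeasure (distr (?H \<Otimes>\<^sub>M ?F) ?H hist_cons) (prod_emb UNIV (\<lambda>_. \<mu>) J (Pi\<^sub>E J E))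
        = emeasure (?H \<Otimes>\<^sub>M ?F) (?EA \<times> ?EB)"
      using J E by (subst emeasure_distr[OF measurable_hist_cons]) (auto intro!: sets_PiM_I)
    also have "\<dots> = emeasure ?H ?EA * emeasure ?F ?EB"
      using fin EA EB by (intro F.P.emeasure_pair_measure_Times) (auto intro!: sets_PiM_I)
    also have "emeasure ?H ?EA = (\<Prod>i\<in>A. emeasure \<mu> (E (Suc (fst i), snd i)))"
      using fin EA by (subst H.emeasure_PiM_emb) (auto simp: split_beta')
    also have "emeasure ?F ?EB = (\<Prod>z\<in>B. emeasure \<mu> (E (0, z)))"
      using fin EB by (subst F.emeasure_PiM_emb) auto
    also have "(\<Prod>i\<in>A. emeasure \<mu> (E (Suc (fst i), snd i))) * (\<Prod>z\<in>B. emeasure \<mu> (E (0, z)))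
        = (\<Prod>j\<in>J. emeasure \<mu> (E j))"
      unfolding J_eq using fin inj
      by (subst prod.union_disjoint) (auto simp: prod.reindex[OF inj(2)] prod.reindex split_beta')
    finally show "emeasure (distr (?H \<Otimes>\<^sub>M ?F) ?H hist_cons) (prod_emb UNIV (\<lambda>_. \<mu>) J (Pi\<^sub>E J E))
        = (\<Prod>j\<in>J. emeasure \<mu> (E j))" .
  qed simp
qed

section \<open>Energy dissipation of the kernel\<close>

lemma finite_int_vec_box: "finite {x :: int ^ 'd::finite. \<forall>i. \<bar>x $ i\<bar> \<le> M}"
proof (rule finite_imageD)
  have "vec_nth ` {x :: int ^ 'd. \<forall>i. \<bar>x $ i\<bar> \<le> M} \<subseteq> PiE UNIV (\<lambda>_. {-M..M})"
    by (auto simp: PiE_def abs_le_iff minus_le_iff)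
  then show "finite (vec_nth ` {x :: int ^ 'd. \<forall>i. \<bar>x $ i\<bar> \<le> M})"
    by (rule finite_subset) (intro finite_PiE; simp)
qed (auto simp: inj_on_def vec_eq_iff)

text \<open>Bounded range of the kernel keeps the iterated kernels finitely supported. This
  predicate settles the summability conditions whenever lattice sums are split or exchanged.\<close>

definition fin_supp :: "('a \<Rightarrow> real) \<Rightarrow> bool" where
  "fin_supp f \<longleftrightarrow> finite {z. f z \<noteq> 0}"

lemma fin_supp_summable: "fin_supp f \<Longrightarrow> f summable_on A"
  unfolding fin_supp_def
  by (rule finite_nonzero_values_imp_summable_on) (auto elim: rev_finite_subset)

lemma fin_supp_mult_left: "fin_supp f \<Longrightarrow> fin_supp (\<lambda>z. g z * f z)"
  unfolding fin_supp_def by (auto elim: rev_finite_subset)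

lemma fin_supp_power2: "fin_supp f \<Longrightarrow> fin_supp (\<lambda>z. (f z)\<^sup>2)"
  unfolding fin_supp_def by simp

lemma fin_supp_diff:
  assumes "fin_supp f" "fin_supp g"
  shows "fin_supp (\<lambda>z. f z - g z)"
  using finite_UnI[OF assms[unfolded fin_supp_def]]
  unfolding fin_supp_def by (rule rev_finite_subset) auto

lemma fin_supp_sum:
  assumes "finite A" and "\<And>i. i \<in> A \<Longrightarrow> fin_supp (f i)"
  shows "fin_supp (\<lambda>z. \<Sum>i\<in>A. f i z)"
proof -
  have "finite (\<Union>i\<in>A. {z. f i z \<noteq> 0})"
    using assms by (auto simp: fin_supp_def)
  moreover have "{z. (\<Sum>i\<in>A. f i z) \<noteq> 0} \<subseteq> (\<Union>i\<in>A. {z. f i z \<noteq> 0})"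
    by (auto elim!: sum.not_neutral_contains_not_neutral)
  ultimately show ?thesis unfolding fin_supp_def by (rule finite_subset[rotated])
qed

lemma fin_supp_shift:
  fixes f :: "'a::group_add \<Rightarrow> real"
  assumes "fin_supp f"
  shows "fin_supp (\<lambda>z. f (z - x))"
proof -
  have "{z. f (z - x) \<noteq> 0} = (\<lambda>z. z + x) ` {z. f z \<noteq> 0}"
    by (force simp: image_iff)
  then show ?thesis using assms by (simp add: fin_supp_def)
qed

lemma infsum_fin_supp_eq_sum:
  assumes "finite A" and "\<And>z. z \<notin> A \<Longrightarrow> f z = 0"
  shows "infsum f UNIV = sum f A"
proof -
  have "infsum f UNIV = infsum f A"
    using assms by (intro infsum_cong_neutral) auto
  then show ?thesis using assms by simp
qed

lemma infsum_shift:
  fixes f :: "'a::ab_group_add \<Rightarrow> real"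
  shows "(\<Sum>\<^sub>\<infinity>z. f (z - x)) = (\<Sum>\<^sub>\<infinity>z. f z)"
  by (rule infsum_reindex_bij_betw) (auto intro: bij_betw_byWitness[where f'="\<lambda>z. z + x"])

lemma infsum_diff_fin_supp:
  assumes "fin_supp f" "fin_supp g"
  shows "(\<Sum>\<^sub>\<infinity>z. f z - g z) = (\<Sum>\<^sub>\<infinity>z. f z) - (\<Sum>\<^sub>\<infinity>z. g z)"
  using infsum_add[of f UNIV "\<lambda>z. - g z"] assms[THEN fin_supp_summable]
  by (simp add: infsum_uminus summable_on_uminus)

lemma infsum_sum_fin_supp:
  assumes "\<And>i. i \<in> A \<Longrightarrow> fin_supp (f i)"
  shows "(\<Sum>\<^sub>\<infinity>z. \<Sum>i\<in>A. f i z) = (\<Sum>i\<in>A. \<Sum>\<^sub>\<infinity>z. f i z)"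
  using assms
proof (induction A rule: infinite_finite_induct)
  case (insert a A)
  then have "(\<Sum>\<^sub>\<infinity>z. f a z + (\<Sum>i\<in>A. f i z)) = (\<Sum>\<^sub>\<infinity>z. f a z) + (\<Sum>\<^sub>\<infinity>z. \<Sum>i\<in>A. f i z)"
    by (intro infsum_add fin_supp_summable fin_supp_sum) auto
  then show ?case using insert by simp
qed auto

section \<open>Summability of the \<open>l^2\<close> increments of the iterated kernel\<close>

definition ksupp :: "(int ^ 'd::finite \<Rightarrow> real) \<Rightarrow> (int ^ 'd) set" where
  "ksupp p = {z. p z \<noteq> 0}"

text \<open>Squared \<open>l^2\<close> distance of \<open>p^k\<close> from its translate by
  \<open>w\<close>. For \<open>w = - unitv i\<close> and multiplied by the noise variance, it is the
  variance of the \<open>k\<close>-th term of \<open>Delta0\<close> in direction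
  \<open>i\<close>.\<close>

definition pk_diff :: "(int ^ 'd::finite \<Rightarrow> real) \<Rightarrow> nat \<Rightarrow> int ^ 'd \<Rightarrow> real" where
  "pk_diff p k w = (\<Sum>\<^sub>\<infinity>z. (pk p k z - pk p k (z - w))\<^sup>2)"

context
  fixes p :: "int ^ 'd::finite \<Rightarrow> real"
  assumes ker: "kernel p"
begin

lemma finite_ksupp: "finite (ksupp p)"
proof -
  obtain M :: int where M: "\<And>x. (\<exists>i. M < \<bar>x $ i\<bar>) \<Longrightarrow> p x = 0"
    using ker unfolding kernel_def by blast
  have "ksupp p \<subseteq> {x. \<forall>i. \<bar>x $ i\<bar> \<le> M}"
    using M by (force simp: ksupp_def not_less[symmetric])
  then show ?thesis by (rule finite_subset) (rule finite_int_vec_box)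
qed

lemma kernel_nonneg: "0 \<le> p x"
  using ker by (simp add: kernel_def)

lemma infsum_kernel: "(\<Sum>\<^sub>\<infinity>z. p z * f z) = (\<Sum>z\<in>ksupp p. p z * f z)"
  by (rule infsum_fin_supp_eq_sum[OF finite_ksupp]) (simp add: ksupp_def)

lemma sum_kernel: "(\<Sum>z\<in>ksupp p. p z) = 1"
proof -
  have "(\<Sum>\<^sub>\<infinity>z. p z) = 1"
    using ker by (simp add: kernel_def infsumI)
  then show ?thesis using infsum_kernel[of "\<lambda>_. 1"] by simp
qed

lemma pk_Suc_sum: "pk p (Suc k) y = (\<Sum>z\<in>ksupp p. p z * pk p k (y - z))"
  by (simp add: infsum_kernel)

lemma fin_supp_pk: "fin_supp (pk p k)"
proof (induction k)
  case 0
  have "{z. pk p 0 z \<noteq> 0} = {0}" by auto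
  then show ?case by (simp add: fin_supp_def)
next
  case (Suc k)
  show ?case
    unfolding pk_Suc_sum
    by (intro fin_supp_sum finite_ksupp fin_supp_mult_left fin_supp_shift Suc)
qed

lemma fin_supp_pk_diff: "fin_supp (\<lambda>z. pk p k (z - x) - pk p k (z - y))"
  by (intro fin_supp_diff fin_supp_shift fin_supp_pk)

lemma pk_diff_shift: "(\<Sum>\<^sub>\<infinity>z. (pk p k (z - x) - pk p k (z - y))\<^sup>2) = pk_diff p k (y - x)"
  using infsum_shift[of "\<lambda>z. (pk p k z - pk p k (z - (y - x)))\<^sup>2" x] by (simp add: pk_diff_def)

lemma pk_diff_nonneg: "0 \<le> pk_diff p k w"
  unfolding pk_diff_def by (intro infsum_nonneg) simp

text \<open>The translates by \<open>a\<close> and by \<open>b\<close> are compared through the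
  untranslated \<open>p^k\<close>. The form \<open>a - b\<close> is what closure under subtraction
  asks of the set of summable directions.\<close>

lemma pk_diff_diff_le: "pk_diff p k (a - b) \<le> 2 * pk_diff p k a + 2 * pk_diff p k b"
proof -
  let ?f = "pk p k"
  have s: "(\<lambda>z. (?f z - ?f (z - w))\<^sup>2) summable_on UNIV" for w
    using fin_supp_pk_diff[of k 0 w] by (intro fin_supp_summable fin_supp_power2) simp
  have "pk_diff p k (a - b) = (\<Sum>\<^sub>\<infinity>z. (?f (z - b) - ?f (z - a))\<^sup>2)"
    by (simp add: pk_diff_shift)
  also have "\<dots> \<le> (\<Sum>\<^sub>\<infinity>z. 2 * (?f z - ?f (z - a))\<^sup>2 + 2 * (?f z - ?f (z - b))\<^sup>2)"
  proof (rule infsum_mono)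
    show "(\<lambda>z. (?f (z - b) - ?f (z - a))\<^sup>2) summable_on UNIV"
      by (intro fin_supp_summable fin_supp_power2 fin_supp_pk_diff)
    show "(\<lambda>z. 2 * (?f z - ?f (z - a))\<^sup>2 + 2 * (?f z - ?f (z - b))\<^sup>2) summable_on UNIV"
      by (intro summable_on_add summable_on_cmult_right s)
    show "(?f (z - b) - ?f (z - a))\<^sup>2 \<le> 2 * (?f z - ?f (z - a))\<^sup>2 + 2 * (?f z - ?f (z - b))\<^sup>2" for z
      \<comment> \<open>The gap between the two sides is exactly this square (parallelogram
        identity).\<close>
      using zero_le_power2[of "2 * ?f z - ?f (z - a) - ?f (z - b)"]
      by (simp add: power2_eq_square algebra_simps)
  qed
  also have "\<dots> = 2 * pk_diff p k a + 2 * pk_diff p k b"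
    unfolding pk_diff_def
    by (subst infsum_add) (auto intro!: summable_on_cmult_right s simp: infsum_cmult_right')
  finally show ?thesis .
qed

text \<open>The left-hand side is twice the Dirichlet form of \<open>p^k\<close> for the symmetrised kernel; the
  right-hand side telescopes in \<open>k\<close>.\<close>
lemma pk_energy:
  "(\<Sum>y\<in>ksupp p. \<Sum>y'\<in>ksupp p. p y * p y' * pk_diff p k (y' - y))
    = 2 * (\<Sum>\<^sub>\<infinity>z. (pk p k z)\<^sup>2) - 2 * (\<Sum>\<^sub>\<infinity>z. (pk p (Suc k) z)\<^sup>2)"
proof -
  let ?f = "pk p k" and ?P = "ksupp p"
  have sq: "(\<lambda>z. (?f (z - y))\<^sup>2) summable_on UNIV" for y
    by (intro fin_supp_summable fin_supp_power2 fin_supp_shift fin_supp_pk)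
  \<comment> \<open>The identity \<open>E (h Y - h Y')^2 = 2 E (h Y)^2 - 2 (E (h Y))^2\<close> for
    independent \<open>Y\<close>, \<open>Y'\<close> with law \<open>p\<close>, where
    \<open>E (h Y)\<close> is \<open>p^(k+1)\<close> at \<open>z\<close>.\<close>
  have pw: "(\<Sum>y\<in>?P. \<Sum>y'\<in>?P. p y * p y' * (?f (z - y) - ?f (z - y'))\<^sup>2)
      = 2 * (\<Sum>y\<in>?P. p y * (?f (z - y))\<^sup>2) - 2 * (pk p (Suc k) z)\<^sup>2" for z
  proof -
    define h where "h y = ?f (z - y)" for y
    have "(\<Sum>y\<in>?P. \<Sum>y'\<in>?P. p y * p y' * (h y - h y')\<^sup>2)
        = (\<Sum>y\<in>?P. \<Sum>y'\<in>?P. (p y * (h y)\<^sup>2) * p y' + p y * (p y' * (h y')\<^sup>2) - 2 * ((p y * h y) * (p y' * h y')))"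
      by (intro sum.cong refl) (simp add: power2_eq_square algebra_simps)
    also have "\<dots> = (\<Sum>y\<in>?P. p y * (h y)\<^sup>2) * (\<Sum>y\<in>?P. p y) + (\<Sum>y\<in>?P. p y) * (\<Sum>y\<in>?P. p y * (h y)\<^sup>2)
        - 2 * ((\<Sum>y\<in>?P. p y * h y) * (\<Sum>y\<in>?P. p y * h y))"
      unfolding sum_product by (simp add: sum.distrib sum_subtractf sum_distrib_left)
    finally show ?thesis
      by (simp add: h_def sum_kernel pk_Suc_sum power2_eq_square del: pk.simps)
  qed
  have "(\<Sum>y\<in>?P. \<Sum>y'\<in>?P. p y * p y' * pk_diff p k (y' - y))
      = (\<Sum>\<^sub>\<infinity>z. \<Sum>y\<in>?P. \<Sum>y'\<in>?P. p y * p y' * (?f (z - y) - ?f (z - y'))\<^sup>2)"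
    unfolding pk_diff_shift[symmetric] infsum_cmult_right'[symmetric]
    by (simp add: infsum_sum_fin_supp fin_supp_sum finite_ksupp fin_supp_mult_left fin_supp_power2
        fin_supp_pk_diff)
  also have "\<dots> = (\<Sum>\<^sub>\<infinity>z. 2 * (\<Sum>y\<in>?P. p y * (?f (z - y))\<^sup>2) - 2 * (pk p (Suc k) z)\<^sup>2)"
    by (simp only: pw)
  also have "\<dots> = 2 * (\<Sum>y\<in>?P. p y * (\<Sum>\<^sub>\<infinity>z. (?f (z - y))\<^sup>2)) - 2 * (\<Sum>\<^sub>\<infinity>z. (pk p (Suc k) z)\<^sup>2)"
    by (simp add: infsum_diff_fin_supp infsum_sum_fin_supp infsum_cmult_right' fin_supp_sum finite_ksupp
        fin_supp_mult_left fin_supp_power2 fin_supp_shift fin_supp_pk del: pk.simps)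
  also have "(\<Sum>y\<in>?P. p y * (\<Sum>\<^sub>\<infinity>z. (?f (z - y))\<^sup>2)) = (\<Sum>\<^sub>\<infinity>z. (?f z)\<^sup>2)"
    using infsum_shift[of "\<lambda>z. (?f z)\<^sup>2"] sum_kernel by (simp add: sum_distrib_right[symmetric])
  finally show ?thesis .
qed

text \<open>All terms of the energy are nonnegative, so a single one is at most the drop
  \<open>2 * N k - 2 * N (Suc k)\<close>, whose sums telescope below \<open>2 * N 0\<close>. The
  weight \<open>p y * p y'\<close> is nonzero and can be divided out.\<close>

lemma summable_pk_diff_support:
  assumes "y \<in> ksupp p" "y' \<in> ksupp p"
  shows "summable (\<lambda>k. pk_diff p k (y' - y))"
proof -
  define N where "N k = (\<Sum>\<^sub>\<infinity>z. (pk p k z)\<^sup>2)" for k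
  have N0: "0 \<le> N k" for k unfolding N_def by (intro infsum_nonneg) simp
  have le: "p y * p y' * pk_diff p k (y' - y) \<le> 2 * N k - 2 * N (Suc k)" for k
  proof -
    have "p y * p y' * pk_diff p k (y' - y) \<le> (\<Sum>y'\<in>ksupp p. p y * p y' * pk_diff p k (y' - y))"
      using assms finite_ksupp by (intro member_le_sum) (auto simp: kernel_nonneg pk_diff_nonneg)
    also have "\<dots> \<le> (\<Sum>y\<in>ksupp p. \<Sum>y'\<in>ksupp p. p y * p y' * pk_diff p k (y' - y))"
      using assms finite_ksupp
      by (intro member_le_sum[where f="\<lambda>y. \<Sum>y'\<in>ksupp p. p y * p y' * pk_diff p k (y' - y)"])
        (auto simp: kernel_nonneg pk_diff_nonneg intro!: sum_nonneg)
    finally show ?thesis by (simp add: pk_energy N_def del: pk.simps)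
  qed
  have "summable (\<lambda>k. p y * p y' * pk_diff p k (y' - y))"
  proof (rule summableI_nonneg_bounded)
    show "0 \<le> p y * p y' * pk_diff p k (y' - y)" for k
      by (simp add: kernel_nonneg pk_diff_nonneg)
    fix n
    have "(\<Sum>k<n. p y * p y' * pk_diff p k (y' - y)) \<le> (\<Sum>k<n. 2 * N k - 2 * N (Suc k))"
      by (intro sum_mono le)
    also have "\<dots> = 2 * N 0 - 2 * N n"
      by (induction n) auto
    finally show "(\<Sum>k<n. p y * p y' * pk_diff p k (y' - y)) \<le> 2 * N 0"
      using N0[of n] by linarith
  qed
  moreover have "p y * p y' \<noteq> 0" using assms by (simp add: ksupp_def)
  ultimately show ?thesis by (metis summable_cmult_iff)
qed

lemma summable_pk_diff: "summable (\<lambda>k. pk_diff p k w)"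
proof -
  define G where "G = {w. summable (\<lambda>k. pk_diff p k w)}"
  obtain y where y: "y \<in> ksupp p"
    using sum_kernel by fastforce
  have "0 \<in> G" by (simp add: G_def pk_diff_def)
  moreover have "a - b \<in> G" if "a \<in> G" "b \<in> G" for a b
    using that unfolding G_def mem_Collect_eq
    by (intro summable_comparison_test'[where N=0 and
          f="\<lambda>k. pk_diff p k (a - b)" and g="\<lambda>k. 2 * pk_diff p k a + 2 * pk_diff p k b"]
        summable_add summable_mult) (auto simp: pk_diff_nonneg pk_diff_diff_le)
  \<comment> \<open>Strong aperiodicity is applied with \<open>u = - y\<close> for a support point
    \<open>y\<close>: the translated support then consists of differences of support points.\<close>
  moreover have "{- y + x | x. p x > 0} \<subseteq> G"
    using summable_pk_diff_support[OF y] by (auto simp: G_def ksupp_def)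
  ultimately have "add_subgroup_generated {- y + x | x. p x > 0} \<subseteq> G"
    unfolding add_subgroup_generated_def by (intro Inter_lower) auto
  moreover have "add_subgroup_generated {- y + x | x. p x > 0} = UNIV"
    using ker unfolding kernel_def by blast
  ultimately show ?thesis by (auto simp: G_def)
qed

end

section \<open>Integration on pairs\<close>

lemma measurable_config_spaceI:
  assumes "\<And>j. (\<lambda>x. f x j) \<in> borel_measurable N"
  shows "f \<in> measurable N config_space"
proof -
  have "(\<lambda>x j. f x j) \<in> measurable N config_space"
    unfolding config_space_def by (rule measurable_PiM_single') (use assms in auto)
  then show ?thesis by simp
qed

lemma measurable_config_coord[measurable]: "(\<lambda>\<eta>. \<eta> j) \<in> borel_measurable config_space"
  unfolding config_space_def by simp

lemma measure_eqI_nn_integral: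
  assumes sets: "sets M = sets N"
    and eq: "\<And>f :: 'a \<Rightarrow> ennreal. f \<in> borel_measurable M \<Longrightarrow> (\<integral>\<^sup>+x. f x \<partial>M) = (\<integral>\<^sup>+x. f x \<partial>N)"
  shows "M = N"
proof (rule measure_eqI[OF sets])
  fix A assume "A \<in> sets M"
  then show "emeasure M A = emeasure N A"
    using eq[of "indicator A"] sets by simp
qed

text \<open>Cauchy-Schwarz against the constant \<open>1\<close>, obtained from nonnegativity of the
  variance of the absolute value.\<close>

lemma (in prob_space) expectation_abs_le_sqrt:
  fixes h :: "'a \<Rightarrow> real"
  assumes [measurable]: "h \<in> borel_measurable M"
    and h2: "integrable M (\<lambda>x. (h x)\<^sup>2)" and le: "expectation (\<lambda>x. (h x)\<^sup>2) \<le> C"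
  shows "expectation (\<lambda>x. \<bar>h x\<bar>) \<le> sqrt C"
proof -
  have "integrable M h" by (rule square_integrable_imp_integrable[OF _ h2]) simp
  then have "variance (\<lambda>x. \<bar>h x\<bar>) = expectation (\<lambda>x. (h x)\<^sup>2) - (expectation (\<lambda>x. \<bar>h x\<bar>))\<^sup>2"
    using variance_eq[of "\<lambda>x. \<bar>h x\<bar>"] h2 by simp
  moreover have "0 \<le> variance (\<lambda>x. \<bar>h x\<bar>)" by (rule variance_positive)
  ultimately show ?thesis using le by (intro real_le_rsqrt) linarith
qed

lemma (in prob_space) distr_pair_snd:
  assumes "prob_space N"
  shows "distr (N \<Otimes>\<^sub>M M) M snd = M"
proof -
  interpret N: prob_space N by fact
  interpret pair_sigma_finite N M ..
  have "distr (N \<Otimes>\<^sub>M M) M snd = distr (distr (M \<Otimes>\<^sub>M N) (N \<Otimes>\<^sub>M M) (\<lambda>(x, y). (y, x))) M snd"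
    by (subst distr_pair_swap) simp
  also have "\<dots> = distr (M \<Otimes>\<^sub>M N) M fst"
    by (subst distr_distr) (auto intro!: distr_cong simp: split_beta' comp_def)
  finally show ?thesis by (simp add: N.distr_pair_fst)
qed

lemma
  fixes f :: "_ \<Rightarrow> real"
  assumes "prob_space N" and f: "f \<in> borel_measurable M"
  shows integrable_pair_fst: "integrable (M \<Otimes>\<^sub>M N) (\<lambda>q. f (fst q)) \<longleftrightarrow> integrable M f"
    and integral_pair_fst: "(\<integral>q. f (fst q) \<partial>(M \<Otimes>\<^sub>M N)) = (\<integral>x. f x \<partial>M)"
proof -
  interpret N: prob_space N by fact
  show "integrable (M \<Otimes>\<^sub>M N) (\<lambda>q. f (fst q)) \<longleftrightarrow> integrable M f"
    using integrable_distr_eq[OF measurable_fst f, of N] unfolding N.distr_pair_fst by (rule sym)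
  show "(\<integral>q. f (fst q) \<partial>(M \<Otimes>\<^sub>M N)) = (\<integral>x. f x \<partial>M)"
    using integral_distr[OF measurable_fst f, of N] unfolding N.distr_pair_fst by (rule sym)
qed

lemma
  fixes f :: "_ \<Rightarrow> real"
  assumes M: "prob_space M" and "prob_space N" and f: "f \<in> borel_measurable N"
  shows integrable_pair_snd: "integrable (M \<Otimes>\<^sub>M N) (\<lambda>q. f (snd q)) \<longleftrightarrow> integrable N f"
    and integral_pair_snd: "(\<integral>q. f (snd q) \<partial>(M \<Otimes>\<^sub>M N)) = (\<integral>x. f x \<partial>N)"
proof -
  interpret N: prob_space N by fact
  show "integrable (M \<Otimes>\<^sub>M N) (\<lambda>q. f (snd q)) \<longleftrightarrow> integrable N f"
    using integrable_distr_eq[OF measurable_snd f, of M] unfolding N.distr_pair_snd[OF M] by (rule sym)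
  show "(\<integral>q. f (snd q) \<partial>(M \<Otimes>\<^sub>M N)) = (\<integral>x. f x \<partial>N)"
    using integral_distr[OF measurable_snd f, of M] unfolding N.distr_pair_snd[OF M] by (rule sym)
qed

text \<open>For fixed \<open>x\<close> the cross term vanishes in the inner integral because
  \<open>g\<close> is centred. The iterated form matches the one in which invariance is
  available.\<close>

lemma nn_integral_indep_shift_sq:
  fixes f g :: "_ \<Rightarrow> real"
  assumes "prob_space N" and [measurable]: "f \<in> borel_measurable M" "g \<in> borel_measurable N"
    and f: "integrable M (\<lambda>x. (f x)\<^sup>2)" and M: "prob_space M"
    and g: "integrable N (\<lambda>y. (g y)\<^sup>2)" "(\<integral>y. g y \<partial>N) = 0"
  shows "(\<integral>\<^sup>+x. \<integral>\<^sup>+y. ennreal ((f x + g y)\<^sup>2) \<partial>N \<partial>M) = ennreal ((\<integral>x. (f x)\<^sup>2 \<partial>M) + (\<integral>y. (g y)\<^sup>2 \<partial>N))"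
proof -
  interpret N: prob_space N by fact
  interpret M: prob_space M by fact
  have g1: "integrable N g"
    by (rule N.square_integrable_imp_integrable) (simp_all add: g)
  have "(\<integral>\<^sup>+y. ennreal ((a + g y)\<^sup>2) \<partial>N) = ennreal (a\<^sup>2 + (\<integral>y. (g y)\<^sup>2 \<partial>N))" for a
  proof -
    have eq: "(a + g y)\<^sup>2 = a\<^sup>2 + 2 * a * g y + (g y)\<^sup>2" for y by (simp add: power2_sum)
    have "integrable N (\<lambda>y. (a + g y)\<^sup>2)" unfolding eq using g g1 by simp
    moreover have "(\<integral>y. (a + g y)\<^sup>2 \<partial>N) = a\<^sup>2 + (\<integral>y. (g y)\<^sup>2 \<partial>N)"
      unfolding eq using g g1 by (simp add: N.prob_space)
    ultimately show ?thesis by (simp add: nn_integral_eq_integral)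
  qed
  then have "(\<integral>\<^sup>+x. \<integral>\<^sup>+y. ennreal ((f x + g y)\<^sup>2) \<partial>N \<partial>M)
      = (\<integral>\<^sup>+x. ennreal ((f x)\<^sup>2 + (\<integral>y. (g y)\<^sup>2 \<partial>N)) \<partial>M)" by simp
  also have "\<dots> = ennreal ((\<integral>x. (f x)\<^sup>2 \<partial>M) + (\<integral>y. (g y)\<^sup>2 \<partial>N))"
    using f by (subst nn_integral_eq_integral) (simp_all add: M.prob_space)
  finally show ?thesis .
qed

section \<open>The increment process\<close>

definition incr_coef :: "(int ^ 'd::finite \<Rightarrow> real) \<Rightarrow> nat \<Rightarrow> (int ^ 'd) \<times> 'd \<Rightarrow> int ^ 'd \<Rightarrow> real" where
  "incr_coef p k j z = pk p k (z - fst j) - pk p k (z - (fst j - unitv (snd j)))"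

text \<open>The \<open>k\<close>-th term of the series \<open>Delta0\<close>. It reads
  \<open>\<omega>\<close> only in layer \<open>k\<close>, which makes the terms independent.\<close>

definition incr :: "(int ^ 'd::finite \<Rightarrow> real) \<Rightarrow> nat \<Rightarrow> (nat \<times> (int ^ 'd) \<Rightarrow> real) \<Rightarrow> 'd config" where
  "incr p k \<omega> j = (\<Sum>\<^sub>\<infinity>z. \<omega> (k, z) * incr_coef p k j z)"

lemma Delta0_eq_suminf_incr: "Delta0 p \<omega> j = (\<Sum>k. incr p k \<omega> j)"
  by (cases j) (simp add: Delta0_def incr_def incr_coef_def)

text \<open>The operator \<open>P\<close> of the overview: one step of the chain with the noise
  removed.\<close>

definition tavg :: "(int ^ 'd::finite \<Rightarrow> real) \<Rightarrow> 'd config \<Rightarrow> 'd config" where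
  "tavg p \<eta> = (\<lambda>(x, i). \<Sum>\<^sub>\<infinity>z. p z * \<eta> (x + z, i))"

lemma step_eq_tavg: "step p \<eta> \<xi> (x, i) = tavg p \<eta> (x, i) + \<xi> x - \<xi> (x - unitv i)"
  by (simp add: step_def tavg_def)

text \<open>The chain started in \<open>\<eta>\<close> after \<open>n\<close> steps; layer \<open>0\<close> of \<open>\<omega>\<close> is the most recent noise.\<close>
definition chain :: "(int ^ 'd::finite \<Rightarrow> real) \<Rightarrow> nat \<Rightarrow> 'd config \<Rightarrow> (nat \<times> (int ^ 'd) \<Rightarrow> real) \<Rightarrow> 'd config" where
  "chain p n \<eta> \<omega> j = (tavg p ^^ n) \<eta> j + (\<Sum>k<n. incr p k \<omega> j)"

text \<open>\<open>p^0\<close> is a point mass, so the newest layer contributes exactly the noise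
  difference that \<open>step\<close> adds.\<close>

lemma incr_hist_cons_0: "incr p 0 (hist_cons (\<omega>, \<xi>)) (x, i) = \<xi> x - \<xi> (x - unitv i)"
proof -
  have s: "fin_supp (\<lambda>z. \<xi> z * pk p 0 (z - y))" "(\<Sum>\<^sub>\<infinity>z. \<xi> z * pk p 0 (z - y)) = \<xi> y" for y
  proof -
    have "{z. \<xi> z * pk p 0 (z - y) \<noteq> 0} \<subseteq> {y}" by auto
    then show "fin_supp (\<lambda>z. \<xi> z * pk p 0 (z - y))"
      unfolding fin_supp_def by (rule finite_subset) simp
    show "(\<Sum>\<^sub>\<infinity>z. \<xi> z * pk p 0 (z - y)) = \<xi> y"
      by (subst infsum_fin_supp_eq_sum[where A="{y}"]) auto
  qed
  show ?thesis
    unfolding incr_def incr_coef_def hist_cons_simps right_diff_distrib fst_conv snd_conv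
    by (simp only: infsum_diff_fin_supp s)
qed

section \<open>The recursion shared by the chain and by the series\<close>

context
  fixes p :: "int ^ 'd::finite \<Rightarrow> real"
  assumes ker: "kernel p"
begin

lemma tavg_eq_sum: "tavg p \<eta> (x, i) = (\<Sum>y\<in>ksupp p. p y * \<eta> (x + y, i))"
  by (simp add: tavg_def infsum_kernel[OF ker])

lemma tavg_add: "tavg p (\<lambda>j. \<eta> j + \<zeta> j) j = tavg p \<eta> j + tavg p \<zeta> j"
  by (cases j) (simp add: tavg_eq_sum sum.distrib distrib_left)

lemma tavg_sum: "tavg p (\<lambda>j. \<Sum>k\<in>A. f k j) j = (\<Sum>k\<in>A. tavg p (f k) j)"
  by (cases j) (simp add: tavg_eq_sum sum_distrib_left sum.swap[of _ A])

lemma fin_supp_incr_coef: "fin_supp (incr_coef p k j)"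
  unfolding incr_coef_def by (rule fin_supp_pk_diff[OF ker])

lemma incr_eq_sum:
  "incr p k \<omega> j = (\<Sum>z\<in>{z. incr_coef p k j z \<noteq> 0}. \<omega> (k, z) * incr_coef p k j z)"
  unfolding incr_def
  using fin_supp_incr_coef by (intro infsum_fin_supp_eq_sum) (auto simp: fin_supp_def)

lemma incr_coef_Suc: "incr_coef p (Suc k) (x, i) z = (\<Sum>y\<in>ksupp p. p y * incr_coef p k (x + y, i) z)"
  unfolding incr_coef_def pk_Suc_sum[OF ker] fst_conv snd_conv sum_subtractf[symmetric]
  by (intro sum.cong refl) (simp add: algebra_simps)

text \<open>Ageing a term by one time unit is the same as averaging it once over the kernel, by the
  first-step decomposition of \<open>p^(k+1)\<close>.\<close>

lemma incr_hist_cons_Suc: "incr p (Suc k) (hist_cons (\<omega>, \<xi>)) j = tavg p (incr p k \<omega>) j"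
proof (cases j)
  case (Pair x i)
  have "incr p (Suc k) (hist_cons (\<omega>, \<xi>)) j
      = (\<Sum>\<^sub>\<infinity>z. \<Sum>y\<in>ksupp p. p y * (\<omega> (k, z) * incr_coef p k (x + y, i) z))"
    by (simp add: incr_def Pair incr_coef_Suc sum_distrib_left mult.left_commute)
  also have "\<dots> = tavg p (incr p k \<omega>) j"
    by (simp add: Pair tavg_eq_sum incr_def infsum_cmult_right' infsum_sum_fin_supp
        fin_supp_mult_left fin_supp_incr_coef)
  finally show ?thesis .
qed

text \<open>Averaging is linear, so a step averages the initial part and each noise term once more,
  and the fresh noise takes the vacated layer \<open>0\<close>.\<close>

lemma chain_Suc: "chain p (Suc n) \<eta> (hist_cons (\<omega>, \<xi>)) = step p (chain p n \<eta> \<omega>) \<xi>"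
proof
  fix j :: "(int ^ 'd) \<times> 'd"
  obtain x i where j: "j = (x, i)" by (cases j)
  have "tavg p (chain p n \<eta> \<omega>) j = tavg p ((tavg p ^^ n) \<eta>) j + (\<Sum>k<n. tavg p (incr p k \<omega>) j)"
    unfolding chain_def[abs_def] tavg_add tavg_sum ..
  then show "chain p (Suc n) \<eta> (hist_cons (\<omega>, \<xi>)) j = step p (chain p n \<eta> \<omega>) \<xi> j"
    by (simp add: chain_def j step_eq_tavg sum.lessThan_Suc_shift incr_hist_cons_0 incr_hist_cons_Suc del: sum.lessThan_Suc)
qed

text \<open>The recursion of \<open>chain_Suc\<close> in the limit: \<open>Delta0\<close> of the
  extended history is one step from \<open>Delta0\<close> of the old one. Convergence permits
  splitting off the first term and exchanging the series with the finite kernel sum.\<close>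

lemma Delta0_hist_cons:
  assumes summ: "\<And>j. summable (\<lambda>k. incr p k \<omega> j)"
  shows "Delta0 p (hist_cons (\<omega>, \<xi>)) = step p (Delta0 p \<omega>) \<xi>"
proof
  fix j :: "(int ^ 'd) \<times> 'd"
  obtain x i where j: "j = (x, i)" by (cases j)
  have s: "summable (\<lambda>k. tavg p (incr p k \<omega>) j)"
    unfolding j tavg_eq_sum by (intro summable_sum summable_mult summ)
  have s': "summable (\<lambda>k. incr p k (hist_cons (\<omega>, \<xi>)) j)"
    by (subst summable_Suc_iff[symmetric]) (use s in \<open>simp add: incr_hist_cons_Suc\<close>)
  have "Delta0 p (hist_cons (\<omega>, \<xi>)) j
      = incr p 0 (hist_cons (\<omega>, \<xi>)) j + (\<Sum>k. incr p (Suc k) (hist_cons (\<omega>, \<xi>)) j)"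
    unfolding Delta0_eq_suminf_incr
    using suminf_split_head[OF s'] by simp
  also have "(\<Sum>k. incr p (Suc k) (hist_cons (\<omega>, \<xi>)) j) = (\<Sum>y\<in>ksupp p. \<Sum>k. p y * incr p k \<omega> (x + y, i))"
    unfolding incr_hist_cons_Suc j tavg_eq_sum by (rule suminf_sum) (rule summable_mult[OF summ])
  also have "\<dots> = tavg p (Delta0 p \<omega>) j"
    by (simp add: j tavg_eq_sum Delta0_eq_suminf_incr suminf_mult summ)
  finally show "Delta0 p (hist_cons (\<omega>, \<xi>)) j = step p (Delta0 p \<omega>) \<xi> j"
    by (simp add: j step_eq_tavg incr_hist_cons_0)
qed

lemma step_add_harmonic:
  assumes "u \<in> harmonic_d p"
  shows "step p (\<lambda>j. u (snd j) (fst j) + \<eta> j) \<xi> j = u (snd j) (fst j) + step p \<eta> \<xi> j"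
proof -
  obtain x i where j: "j = (x, i)" by (cases j)
  have "tavg p (\<lambda>j. u (snd j) (fst j)) j = u i x"
    using assms by (simp add: j tavg_def harmonic_d_def harmonic_def)
  then show ?thesis by (simp add: j step_eq_tavg tavg_add)
qed

lemma measurable_tavg[measurable]:
  assumes [measurable]: "\<And>j. (\<lambda>x. f x j) \<in> borel_measurable N"
  shows "(\<lambda>x. tavg p (f x) j) \<in> borel_measurable N"
  by (cases j) (simp add: tavg_eq_sum)

lemma measurable_tavg_pow[measurable]:
  "(\<lambda>\<eta>. (tavg p ^^ n) \<eta> j) \<in> borel_measurable config_space"
proof (induction n arbitrary: j)
  case (Suc n)
  show ?case
    by (simp add: measurable_tavg Suc)
qed simp

section \<open>Invariance under the noisy step\<close>

context
  fixes \<mu> :: "real measure"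
  assumes noise: "noise_law \<mu>"
begin

lemma prob_space_noise: "prob_space \<mu>" and sets_noise: "sets \<mu> = sets borel"
  and mean_noise: "(\<integral>t. t \<partial>\<mu>) = 0"
  and noise_int: "integrable \<mu> (\<lambda>t. t)" and noise_sq_int: "integrable \<mu> (\<lambda>t. t\<^sup>2)"
  using noise by (auto simp: noise_law_def)

lemma prob_space_noise_hist: "prob_space (noise_hist \<mu>)"
  unfolding noise_hist_def by (intro prob_space_PiM prob_space_noise)

lemma prob_space_noise_field: "prob_space (noise_field \<mu>)"
  unfolding noise_field_def by (intro prob_space_PiM prob_space_noise)

lemma measurable_noise_ident: "f \<in> measurable N \<mu> \<Longrightarrow> f \<in> borel_measurable N"
  by (simp add: measurable_cong_sets[OF refl sets_noise])

lemma measurable_noise_hist_coord[measurable]: "(\<lambda>\<omega>. \<omega> i) \<in> borel_measurable (noise_hist \<mu>)"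
  unfolding noise_hist_def by (intro measurable_noise_ident measurable_component_singleton) simp

lemma measurable_noise_field_coord[measurable]: "(\<lambda>\<omega>. \<omega> i) \<in> borel_measurable (noise_field \<mu>)"
  unfolding noise_field_def by (intro measurable_noise_ident measurable_component_singleton) simp

lemma measurable_hist_cons_noise[measurable]:
  "hist_cons \<in> measurable (noise_hist \<mu> \<Otimes>\<^sub>M noise_field \<mu>) (noise_hist \<mu>)"
  unfolding noise_hist_def noise_field_def by (rule measurable_hist_cons)

lemma measurable_incr[measurable]: "(\<lambda>\<omega>. incr p k \<omega> j) \<in> borel_measurable (noise_hist \<mu>)"
  unfolding incr_eq_sum by measurable

lemma measurable_Delta0[measurable]: "(\<lambda>\<omega>. Delta0 p \<omega> j) \<in> borel_measurable (noise_hist \<mu>)"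
  unfolding Delta0_eq_suminf_incr by measurable

lemma measurable_step[measurable]:
  "(\<lambda>(\<eta>, \<xi>). step p \<eta> \<xi>) \<in> measurable (config_space \<Otimes>\<^sub>M noise_field \<mu>) config_space"
proof (rule measurable_config_spaceI)
  fix j :: "(int ^ 'd) \<times> 'd"
  obtain x i where j: "j = (x, i)" by (cases j)
  show "(\<lambda>q. (case q of (\<eta>, \<xi>) \<Rightarrow> step p \<eta> \<xi>) j) \<in> borel_measurable (config_space \<Otimes>\<^sub>M noise_field \<mu>)"
    by (simp add: j split_beta' step_eq_tavg)
qed

lemma measurable_chain[measurable]:
  "(\<lambda>(\<eta>, \<omega>). chain p n \<eta> \<omega>) \<in> measurable (config_space \<Otimes>\<^sub>M noise_hist \<mu>) config_space"
  by (rule measurable_config_spaceI) (simp add: chain_def split_beta')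

lemma nn_integral_hist_cons:
  assumes [measurable]: "f \<in> borel_measurable (noise_hist \<mu>)"
  shows "(\<integral>\<^sup>+\<omega>. f \<omega> \<partial>noise_hist \<mu>)
    = (\<integral>\<^sup>+\<omega>. \<integral>\<^sup>+\<xi>. f (hist_cons (\<omega>, \<xi>)) \<partial>noise_field \<mu> \<partial>noise_hist \<mu>)"
proof -
  interpret F: prob_space "noise_field \<mu>" by (rule prob_space_noise_field)
  have "noise_hist \<mu> = distr (noise_hist \<mu> \<Otimes>\<^sub>M noise_field \<mu>) (noise_hist \<mu>) hist_cons"
    unfolding noise_hist_def noise_field_def by (rule distr_hist_cons[OF prob_space_noise, symmetric])
  then have "(\<integral>\<^sup>+\<omega>. f \<omega> \<partial>noise_hist \<mu>)
      = (\<integral>\<^sup>+\<omega>. f \<omega> \<partial>distr (noise_hist \<mu> \<Otimes>\<^sub>M noise_field \<mu>) (noise_hist \<mu>) hist_cons)"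
    by (rule arg_cong[where f="\<lambda>M. integral\<^sup>N M f"])
  also have "\<dots> = (\<integral>\<^sup>+q. f (hist_cons q) \<partial>(noise_hist \<mu> \<Otimes>\<^sub>M noise_field \<mu>))"
    by (subst nn_integral_distr) auto
  also have "\<dots> = (\<integral>\<^sup>+\<omega>. \<integral>\<^sup>+\<xi>. f (hist_cons (\<omega>, \<xi>)) \<partial>noise_field \<mu> \<partial>noise_hist \<mu>)"
    by (subst F.nn_integral_fst[symmetric]) auto
  finally show ?thesis .
qed

text \<open>Invariance is used in the form of iterated integrals, which avoids reassociating triple product
  measures.\<close>
lemma invariant_measuresD:
  assumes "\<nu> \<in> invariant_measures p \<mu>"
  shows "prob_space \<nu>" "sets \<nu> = sets config_space"
    "f \<in> borel_measurable config_space \<Longrightarrow>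
      (\<integral>\<^sup>+\<eta>. f \<eta> \<partial>\<nu>) = (\<integral>\<^sup>+\<eta>. \<integral>\<^sup>+\<xi>. f (step p \<eta> \<xi>) \<partial>noise_field \<mu> \<partial>\<nu>)"
proof -
  show "prob_space \<nu>" and s[measurable_cong]: "sets \<nu> = sets config_space"
    using assms by (auto simp: invariant_measures_def)
  interpret F: prob_space "noise_field \<mu>" by (rule prob_space_noise_field)
  assume [measurable]: "f \<in> borel_measurable config_space"
  have "\<nu> = distr (\<nu> \<Otimes>\<^sub>M noise_field \<mu>) config_space (\<lambda>(\<eta>, \<xi>). step p \<eta> \<xi>)"
    using assms by (auto simp: invariant_measures_def)
  then have "(\<integral>\<^sup>+\<eta>. f \<eta> \<partial>\<nu>)
      = (\<integral>\<^sup>+\<eta>. f \<eta> \<partial>distr (\<nu> \<Otimes>\<^sub>M noise_field \<mu>) config_space (\<lambda>(\<eta>, \<xi>). step p \<eta> \<xi>))"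
    by (rule arg_cong[where f="\<lambda>M. integral\<^sup>N M f"])
  also have "\<dots> = (\<integral>\<^sup>+q. f (case q of (\<eta>, \<xi>) \<Rightarrow> step p \<eta> \<xi>) \<partial>(\<nu> \<Otimes>\<^sub>M noise_field \<mu>))"
    by (subst nn_integral_distr) auto
  also have "\<dots> = (\<integral>\<^sup>+\<eta>. \<integral>\<^sup>+\<xi>. f (step p \<eta> \<xi>) \<partial>noise_field \<mu> \<partial>\<nu>)"
    by (subst F.nn_integral_fst[symmetric]) auto
  finally show "(\<integral>\<^sup>+\<eta>. f \<eta> \<partial>\<nu>) = (\<integral>\<^sup>+\<eta>. \<integral>\<^sup>+\<xi>. f (step p \<eta> \<xi>) \<partial>noise_field \<mu> \<partial>\<nu>)" .
qed

lemma invariant_measuresI: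
  assumes "prob_space \<nu>" and s[measurable_cong]: "sets \<nu> = sets config_space"
    and eq: "\<And>f. f \<in> borel_measurable config_space \<Longrightarrow>
      (\<integral>\<^sup>+\<eta>. f \<eta> \<partial>\<nu>) = (\<integral>\<^sup>+\<eta>. \<integral>\<^sup>+\<xi>. f (step p \<eta> \<xi>) \<partial>noise_field \<mu> \<partial>\<nu>)"
  shows "\<nu> \<in> invariant_measures p \<mu>"
proof -
  interpret F: prob_space "noise_field \<mu>" by (rule prob_space_noise_field)
  have "distr (\<nu> \<Otimes>\<^sub>M noise_field \<mu>) config_space (\<lambda>(\<eta>, \<xi>). step p \<eta> \<xi>) = \<nu>"
  proof (rule measure_eqI_nn_integral)
    fix f :: "_ \<Rightarrow> ennreal" assume "f \<in> borel_measurable (distr (\<nu> \<Otimes>\<^sub>M noise_field \<mu>) config_space (\<lambda>(\<eta>, \<xi>). step p \<eta> \<xi>))"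
    then have f[measurable]: "f \<in> borel_measurable config_space" by simp
    show "(\<integral>\<^sup>+\<eta>. f \<eta> \<partial>distr (\<nu> \<Otimes>\<^sub>M noise_field \<mu>) config_space (\<lambda>(\<eta>, \<xi>). step p \<eta> \<xi>)) = (\<integral>\<^sup>+\<eta>. f \<eta> \<partial>\<nu>)"
      unfolding eq[OF f]
      by (subst nn_integral_distr, (auto)[2], subst F.nn_integral_fst[symmetric]) auto
  qed (simp add: s)
  then show ?thesis using assms by (simp add: invariant_measures_def)
qed

text \<open>The newest noise is peeled off first, so the induction hypothesis is applied to
  \<open>f\<close> averaged over one step, which is why \<open>f\<close> is generalised. One use of
  invariance then removes that step.\<close>

lemma nn_integral_chain:
  assumes \<nu>: "\<nu> \<in> invariant_measures p \<mu>" and "f \<in> borel_measurable config_space"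
  shows "(\<integral>\<^sup>+\<eta>. \<integral>\<^sup>+\<omega>. f (chain p n \<eta> \<omega>) \<partial>noise_hist \<mu> \<partial>\<nu>) = (\<integral>\<^sup>+\<eta>. f \<eta> \<partial>\<nu>)"
  using assms(2)
proof (induction n arbitrary: f)
  case 0
  interpret H: prob_space "noise_hist \<mu>" by (rule prob_space_noise_hist)
  show ?case by (simp add: chain_def H.emeasure_space_1)
next
  case (Suc n)
  note [measurable] = Suc.prems and [measurable_cong] = invariant_measuresD(2)[OF \<nu>]
  interpret F: prob_space "noise_field \<mu>" by (rule prob_space_noise_field)
  have "(\<integral>\<^sup>+\<omega>. f (chain p (Suc n) \<eta> \<omega>) \<partial>noise_hist \<mu>)
      = (\<integral>\<^sup>+\<omega>. \<integral>\<^sup>+\<xi>. f (step p (chain p n \<eta> \<omega>) \<xi>) \<partial>noise_field \<mu> \<partial>noise_hist \<mu>)"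
    if "\<eta> \<in> space \<nu>" for \<eta>
  proof -
    have [measurable]: "chain p m \<eta> \<in> measurable (noise_hist \<mu>) config_space" for m
      by (rule measurable_config_spaceI) (simp add: chain_def)
    show ?thesis by (subst nn_integral_hist_cons) (auto simp: chain_Suc)
  qed
  then have "(\<integral>\<^sup>+\<eta>. \<integral>\<^sup>+\<omega>. f (chain p (Suc n) \<eta> \<omega>) \<partial>noise_hist \<mu> \<partial>\<nu>)
      = (\<integral>\<^sup>+\<eta>. \<integral>\<^sup>+\<omega>. (\<integral>\<^sup>+\<xi>. f (step p (chain p n \<eta> \<omega>) \<xi>) \<partial>noise_field \<mu>) \<partial>noise_hist \<mu> \<partial>\<nu>)"
    by (rule nn_integral_cong)
  also have "\<dots> = (\<integral>\<^sup>+\<eta>. \<integral>\<^sup>+\<xi>. f (step p \<eta> \<xi>) \<partial>noise_field \<mu> \<partial>\<nu>)"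
    by (rule Suc.IH) measurable
  also have "\<dots> = (\<integral>\<^sup>+\<eta>. f \<eta> \<partial>\<nu>)"
    by (rule invariant_measuresD(3)[OF \<nu> Suc.prems, symmetric])
  finally show ?case .
qed

lemma distr_chain:
  assumes \<nu>: "\<nu> \<in> invariant_measures p \<mu>"
  shows "distr (\<nu> \<Otimes>\<^sub>M noise_hist \<mu>) config_space (\<lambda>(\<eta>, \<omega>). chain p n \<eta> \<omega>) = \<nu>"
proof (rule measure_eqI_nn_integral)
  note s[measurable_cong] = invariant_measuresD(2)[OF \<nu>]
  interpret H: prob_space "noise_hist \<mu>" by (rule prob_space_noise_hist)
  show "sets (distr (\<nu> \<Otimes>\<^sub>M noise_hist \<mu>) config_space (\<lambda>(\<eta>, \<omega>). chain p n \<eta> \<omega>)) = sets \<nu>" by (simp add: s)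
  fix f :: "_ \<Rightarrow> ennreal" assume "f \<in> borel_measurable (distr (\<nu> \<Otimes>\<^sub>M noise_hist \<mu>) config_space (\<lambda>(\<eta>, \<omega>). chain p n \<eta> \<omega>))"
  then have f[measurable]: "f \<in> borel_measurable config_space" by simp
  show "(\<integral>\<^sup>+\<eta>. f \<eta> \<partial>distr (\<nu> \<Otimes>\<^sub>M noise_hist \<mu>) config_space (\<lambda>(\<eta>, \<omega>). chain p n \<eta> \<omega>)) = (\<integral>\<^sup>+\<eta>. f \<eta> \<partial>\<nu>)"
    unfolding nn_integral_chain[OF \<nu> f, of n, symmetric]
    by (subst nn_integral_distr, (auto)[2], subst H.nn_integral_fst[symmetric]) auto
qed

section \<open>Moments of the noise terms and of \<open>Delta0\<close>\<close>

lemma noise_coord_integral: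
  fixes f :: "real \<Rightarrow> real"
  assumes [measurable]: "f \<in> borel_measurable borel"
  shows "(\<integral>\<omega>. f (\<omega> i) \<partial>noise_hist \<mu>) = (\<integral>t. f t \<partial>\<mu>)"
    and "integrable (noise_hist \<mu>) (\<lambda>\<omega>. f (\<omega> i)) \<longleftrightarrow> integrable \<mu> f"
proof -
  interpret \<mu>: prob_space \<mu> by (rule prob_space_noise)
  interpret product_prob_space "\<lambda>_. \<mu>" UNIV by unfold_locales
  have d: "distr (noise_hist \<mu>) \<mu> (\<lambda>\<omega>. \<omega> i) = \<mu>"
    unfolding noise_hist_def by (rule PiM_component) simp
  have m: "(\<lambda>\<omega>. \<omega> i) \<in> measurable (noise_hist \<mu>) \<mu>"
    unfolding noise_hist_def by simp
  have f: "f \<in> borel_measurable \<mu>" using assms by (simp add: measurable_cong_sets[OF sets_noise refl])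
  show "(\<integral>\<omega>. f (\<omega> i) \<partial>noise_hist \<mu>) = (\<integral>t. f t \<partial>\<mu>)"
    using integral_distr[OF m f] by (simp add: d)
  show "integrable (noise_hist \<mu>) (\<lambda>\<omega>. f (\<omega> i)) \<longleftrightarrow> integrable \<mu> f"
    using integrable_distr_eq[OF m f] by (simp add: d)
qed

lemma noise_field_coord:
  "integrable (noise_field \<mu>) (\<lambda>\<xi>. \<xi> x)" "(\<integral>\<xi>. \<xi> x \<partial>noise_field \<mu>) = 0"
proof -
  interpret \<mu>: prob_space \<mu> by (rule prob_space_noise)
  interpret product_prob_space "\<lambda>_. \<mu>" UNIV by unfold_locales
  have d: "distr (noise_field \<mu>) \<mu> (\<lambda>\<omega>. \<omega> x) = \<mu>"
    unfolding noise_field_def by (rule PiM_component) simp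
  have m: "(\<lambda>\<omega>. \<omega> x) \<in> measurable (noise_field \<mu>) \<mu>"
    unfolding noise_field_def by simp
  have f: "(\<lambda>t. t) \<in> borel_measurable \<mu>" by (simp add: measurable_cong_sets[OF sets_noise refl])
  show "integrable (noise_field \<mu>) (\<lambda>\<xi>. \<xi> x)"
    using integrable_distr_eq[OF m f] noise_int by (simp add: d)
  show "(\<integral>\<xi>. \<xi> x \<partial>noise_field \<mu>) = 0"
    using integral_distr[OF m f] mean_noise by (simp add: d)
qed

lemma indep_vars_noise_hist_coords:
  "prob_space.indep_vars (noise_hist \<mu>) (\<lambda>_. borel) (\<lambda>i \<omega>. \<omega> i) UNIV"
  unfolding noise_hist_def by (rule indep_vars_PiM_coords[OF prob_space_noise sets_noise])

text \<open>Distinct terms are functions of disjoint layers of independent coordinates.\<close>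

lemma indep_vars_incr:
  "prob_space.indep_vars (noise_hist \<mu>) (\<lambda>_. borel) (\<lambda>k \<omega>. incr p k \<omega> j) UNIV"
proof -
  interpret H: prob_space "noise_hist \<mu>" by (rule prob_space_noise_hist)
  have "H.indep_vars (\<lambda>k. PiM ({k} \<times> UNIV) (\<lambda>_. borel))
      (\<lambda>k \<omega>. restrict (\<lambda>i. \<omega> i) ({k} \<times> UNIV)) UNIV"
    by (rule H.indep_vars_restrict[OF indep_vars_noise_hist_coords]) (auto simp: disjoint_family_on_def)
  then have "H.indep_vars (\<lambda>_. borel)
      (\<lambda>k \<omega>. (\<lambda>y. \<Sum>z\<in>{z. incr_coef p k j z \<noteq> 0}. y (k, z) * incr_coef p k j z)
        (restrict (\<lambda>i. \<omega> i) ({k} \<times> UNIV))) UNIV"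
    by (rule H.indep_vars_compose2)
      (auto intro!: borel_measurable_sum borel_measurable_times measurable_component_singleton)
  then show ?thesis by (simp add: incr_eq_sum)
qed

text \<open>The second moment of the \<open>k\<close>-th term. By translation invariance the site
  drops out and only the direction remains; \<open>- unitv i\<close> is the displacement from
  \<open>x\<close> to \<open>x - unitv i\<close>.\<close>

definition incr_var :: "nat \<Rightarrow> 'd \<Rightarrow> real" where
  "incr_var k i = (\<integral>t. t\<^sup>2 \<partial>\<mu>) * pk_diff p k (- unitv i)"

lemma incr_var_nonneg: "0 \<le> incr_var k i"
  unfolding incr_var_def by (simp add: pk_diff_nonneg[OF ker])

lemma summable_incr_var: "summable (\<lambda>k. incr_var k i)"
  unfolding incr_var_def by (rule summable_mult[OF summable_pk_diff[OF ker]])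

text \<open>Each term is a finite linear combination of i.i.d. centred coordinates, so its second
  moment is the noise variance times the squared \<open>l^2\<close> norm of the
  coefficients.\<close>

lemma incr_moments:
  shows incr_sq_integrable: "integrable (noise_hist \<mu>) (\<lambda>\<omega>. (incr p k \<omega> j)\<^sup>2)"
    and incr_mean: "(\<integral>\<omega>. incr p k \<omega> j \<partial>noise_hist \<mu>) = 0"
    and incr_second_moment: "(\<integral>\<omega>. (incr p k \<omega> j)\<^sup>2 \<partial>noise_hist \<mu>) = incr_var k (snd j)"
proof -
  interpret H: prob_space "noise_hist \<mu>" by (rule prob_space_noise_hist)
  define c where "c = incr_coef p k j"
  define A where "A = {z. c z \<noteq> 0}"
  have A: "finite A" using fin_supp_incr_coef[of k j] by (simp add: A_def c_def fin_supp_def)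
  have incr: "incr p k \<omega> j = (\<Sum>i\<in>Pair k ` A. \<omega> i * c (snd i))" for \<omega>
    by (subst sum.reindex) (simp_all add: inj_on_def incr_eq_sum c_def A_def)
  have ind: "H.indep_vars (\<lambda>_. borel) (\<lambda>i \<omega>. \<omega> i * c (snd i)) UNIV"
    by (rule H.indep_vars_compose2[OF indep_vars_noise_hist_coords, where Y="\<lambda>i t. t * c (snd i)"]) simp
  have sq: "integrable (noise_hist \<mu>) (\<lambda>\<omega>. (\<omega> i * c (snd i))\<^sup>2)" for i
    using noise_coord_integral(2)[of "\<lambda>t. t\<^sup>2" i] noise_sq_int by (simp add: power_mult_distrib)
  have int: "integrable (noise_hist \<mu>) (\<lambda>\<omega>. \<omega> i * c (snd i))" for i
    by (intro integrable_mult_left iffD2[OF noise_coord_integral(2)[of "\<lambda>t. t" i]] noise_int) simp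
  have mean: "(\<integral>\<omega>. \<omega> i * c (snd i) \<partial>noise_hist \<mu>) = 0" for i
    using trans[OF noise_coord_integral(1)[of "\<lambda>t. t" i] mean_noise] by simp
  show "integrable (noise_hist \<mu>) (\<lambda>\<omega>. (incr p k \<omega> j)\<^sup>2)"
    unfolding incr by (rule integrable_sum_square) (simp_all add: sq)
  show "(\<integral>\<omega>. incr p k \<omega> j \<partial>noise_hist \<mu>) = 0"
    unfolding incr by (subst Bochner_Integration.integral_sum; simp only: int mean sum.neutral_const)
  have "(\<integral>\<omega>. (incr p k \<omega> j)\<^sup>2 \<partial>noise_hist \<mu>) = (\<Sum>i\<in>Pair k ` A. \<integral>\<omega>. (\<omega> i * c (snd i))\<^sup>2 \<partial>noise_hist \<mu>)"
    unfolding incr by (rule H.expectation_indep_sum_sq[OF ind sq mean])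
  also have "\<dots> = (\<Sum>z\<in>A. (\<integral>t. t\<^sup>2 \<partial>\<mu>) * (c z)\<^sup>2)"
    using noise_coord_integral(1)[of "\<lambda>t. t\<^sup>2" "(k, z :: int ^ 'd)" for z]
    by (subst sum.reindex) (simp_all add: inj_on_def power_mult_distrib)
  also have "\<dots> = (\<integral>t. t\<^sup>2 \<partial>\<mu>) * (\<Sum>\<^sub>\<infinity>z. (c z)\<^sup>2)"
    using A by (subst infsum_fin_supp_eq_sum[where A=A]) (simp_all add: A_def sum_distrib_left)
  also have "(\<Sum>\<^sub>\<infinity>z. (c z)\<^sup>2) = pk_diff p k (- unitv (snd j))"
    using pk_diff_shift[OF ker, of k "fst j" "fst j - unitv (snd j)"] by (simp add: c_def incr_coef_def)
  finally show "(\<integral>\<omega>. (incr p k \<omega> j)\<^sup>2 \<partial>noise_hist \<mu>) = incr_var k (snd j)"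
    by (simp add: incr_var_def)
qed

text \<open>There are countably many pairs \<open>j\<close>, so one null set serves them all, as the
  simultaneous convergence in \<open>Delta0_hist_cons\<close> requires.\<close>

lemma AE_summable_incr: "AE \<omega> in noise_hist \<mu>. \<forall>j. summable (\<lambda>k. incr p k \<omega> j)"
proof -
  interpret H: prob_space "noise_hist \<mu>" by (rule prob_space_noise_hist)
  show ?thesis
    unfolding AE_all_countable
    by (intro allI H.AE_summable_indep[OF indep_vars_incr incr_sq_integrable incr_mean])
      (simp add: incr_second_moment summable_incr_var)
qed

lemma Delta0_tail:
  shows Delta0_tail_integrable:
      "integrable (noise_hist \<mu>) (\<lambda>\<omega>. (Delta0 p \<omega> j - (\<Sum>k<n. incr p k \<omega> j))\<^sup>2)"
    and Delta0_tail_le: "(\<integral>\<omega>. (Delta0 p \<omega> j - (\<Sum>k<n. incr p k \<omega> j))\<^sup>2 \<partial>noise_hist \<mu>)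
      \<le> (\<Sum>k. incr_var (k + n) (snd j))"
proof -
  interpret H: prob_space "noise_hist \<mu>" by (rule prob_space_noise_hist)
  note T = H.indep_series_tail_sq[OF indep_vars_incr[of j] incr_sq_integrable incr_mean]
  show "integrable (noise_hist \<mu>) (\<lambda>\<omega>. (Delta0 p \<omega> j - (\<Sum>k<n. incr p k \<omega> j))\<^sup>2)"
    unfolding Delta0_eq_suminf_incr by (rule T) (simp add: incr_second_moment summable_incr_var)
  show "(\<integral>\<omega>. (Delta0 p \<omega> j - (\<Sum>k<n. incr p k \<omega> j))\<^sup>2 \<partial>noise_hist \<mu>)
      \<le> (\<Sum>k. incr_var (k + n) (snd j))"
    using T(2)[of n] by (simp add: Delta0_eq_suminf_incr incr_second_moment summable_incr_var)
qed

lemma Delta0_sq_integrable: "integrable (noise_hist \<mu>) (\<lambda>\<omega>. (Delta0 p \<omega> j)\<^sup>2)"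
  and Delta0_second_moment_le:
    "(\<integral>\<omega>. (Delta0 p \<omega> j)\<^sup>2 \<partial>noise_hist \<mu>) \<le> (\<Sum>k. incr_var k (snd j))"
  using Delta0_tail_integrable[of j 0] Delta0_tail_le[of j 0] by simp_all

lemma Delta0_integrable: "integrable (noise_hist \<mu>) (\<lambda>\<omega>. Delta0 p \<omega> j)"
proof -
  interpret H: prob_space "noise_hist \<mu>" by (rule prob_space_noise_hist)
  show ?thesis
    by (rule H.square_integrable_imp_integrable[OF _ Delta0_sq_integrable]) simp
qed

section \<open>The measures \<open>pi_u\<close>\<close>

lemma measurable_shifted_Delta0[measurable]:
  "(\<lambda>\<omega> j. u (snd j) (fst j) + Delta0 p \<omega> j) \<in> measurable (noise_hist \<mu>) config_space"
  by (rule measurable_config_spaceI) simp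

lemma pi_u_eq_distr: "pi_u p \<mu> u
    = distr (noise_hist \<mu>) config_space (\<lambda>\<omega> j. u (snd j) (fst j) + Delta0 p \<omega> j)"
  unfolding pi_u_def by (intro distr_cong) auto

text \<open>Extending a history by an independent field preserves its law and, off a null set, acts
  on \<open>Delta0\<close> as \<open>step\<close>; adding a harmonic field commutes with
  \<open>step\<close>.\<close>

lemma pi_u_invariant:
  assumes u: "u \<in> harmonic_d p"
  shows "pi_u p \<mu> u \<in> invariant_measures p \<mu>"
proof (rule invariant_measuresI)
  interpret H: prob_space "noise_hist \<mu>" by (rule prob_space_noise_hist)
  interpret F: prob_space "noise_field \<mu>" by (rule prob_space_noise_field)
  let ?G = "\<lambda>\<omega> j. u (snd j) (fst j) + Delta0 p \<omega> j"
  show "prob_space (pi_u p \<mu> u)"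
    unfolding pi_u_eq_distr by (rule H.prob_space_distr) simp
  show "sets (pi_u p \<mu> u) = sets config_space" by (simp add: pi_u_def)
  fix f :: "'d config \<Rightarrow> ennreal" assume [measurable]: "f \<in> borel_measurable config_space"
  have "(\<integral>\<^sup>+\<eta>. \<integral>\<^sup>+\<xi>. f (step p \<eta> \<xi>) \<partial>noise_field \<mu> \<partial>pi_u p \<mu> u)
      = (\<integral>\<^sup>+\<omega>. \<integral>\<^sup>+\<xi>. f (step p (?G \<omega>) \<xi>) \<partial>noise_field \<mu> \<partial>noise_hist \<mu>)"
    unfolding pi_u_eq_distr by (subst nn_integral_distr) auto
  also have "\<dots> = (\<integral>\<^sup>+\<omega>. \<integral>\<^sup>+\<xi>. f (?G (hist_cons (\<omega>, \<xi>))) \<partial>noise_field \<mu> \<partial>noise_hist \<mu>)"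
  proof (rule nn_integral_cong_AE)
    show "AE \<omega> in noise_hist \<mu>. (\<integral>\<^sup>+\<xi>. f (step p (?G \<omega>) \<xi>) \<partial>noise_field \<mu>)
        = (\<integral>\<^sup>+\<xi>. f (?G (hist_cons (\<omega>, \<xi>))) \<partial>noise_field \<mu>)"
      using AE_summable_incr
    proof (rule eventually_mono)
      fix \<omega> assume "\<forall>j. summable (\<lambda>k. incr p k \<omega> j)"
      then have "?G (hist_cons (\<omega>, \<xi>)) = step p (?G \<omega>) \<xi>" for \<xi>
        unfolding step_add_harmonic[OF u, abs_def] by (subst Delta0_hist_cons) auto
      then show "(\<integral>\<^sup>+\<xi>. f (step p (?G \<omega>) \<xi>) \<partial>noise_field \<mu>)
          = (\<integral>\<^sup>+\<xi>. f (?G (hist_cons (\<omega>, \<xi>))) \<partial>noise_field \<mu>)" by simp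
    qed
  qed
  also have "\<dots> = (\<integral>\<^sup>+\<omega>. f (?G \<omega>) \<partial>noise_hist \<mu>)"
    by (rule nn_integral_hist_cons[symmetric]) measurable
  also have "\<dots> = (\<integral>\<^sup>+\<eta>. f \<eta> \<partial>pi_u p \<mu> u)"
    unfolding pi_u_eq_distr by (subst nn_integral_distr) auto
  finally show "(\<integral>\<^sup>+\<eta>. f \<eta> \<partial>pi_u p \<mu> u)
      = (\<integral>\<^sup>+\<eta>. \<integral>\<^sup>+\<xi>. f (step p \<eta> \<xi>) \<partial>noise_field \<mu> \<partial>pi_u p \<mu> u)" ..
qed

text \<open>The mean of \<open>Delta0\<close> is carried along as an unevaluated term; that it
  vanishes is deduced in \<open>invariant_eq_pi_uI\<close>.\<close>

lemma pi_u_moments: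
  shows pi_u_sq_integrable: "integrable (pi_u p \<mu> u) (\<lambda>\<eta>. (\<eta> j)\<^sup>2)"
    and pi_u_mean: "(\<integral>\<eta>. \<eta> j \<partial>pi_u p \<mu> u)
      = u (snd j) (fst j) + (\<integral>\<omega>. Delta0 p \<omega> j \<partial>noise_hist \<mu>)"
    and pi_u_variance: "variance_of (pi_u p \<mu> u) (\<lambda>\<eta>. \<eta> j)
      = variance_of (noise_hist \<mu>) (\<lambda>\<omega>. Delta0 p \<omega> j)"
proof -
  interpret H: prob_space "noise_hist \<mu>" by (rule prob_space_noise_hist)
  show "integrable (pi_u p \<mu> u) (\<lambda>\<eta>. (\<eta> j)\<^sup>2)"
    unfolding pi_u_eq_distr using Delta0_sq_integrable[of j]
    by (subst integrable_distr_eq) (auto intro!: integrable_add_square)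
  show mean: "(\<integral>\<eta>. \<eta> j \<partial>pi_u p \<mu> u)
      = u (snd j) (fst j) + (\<integral>\<omega>. Delta0 p \<omega> j \<partial>noise_hist \<mu>)"
    unfolding pi_u_eq_distr using Delta0_integrable[of j]
    by (subst integral_distr) (auto simp: H.prob_space)
  show "variance_of (pi_u p \<mu> u) (\<lambda>\<eta>. \<eta> j) = variance_of (noise_hist \<mu>) (\<lambda>\<omega>. Delta0 p \<omega> j)"
    unfolding variance_of_def mean unfolding pi_u_eq_distr
    by (subst integral_distr) auto
qed

lemma variance_Delta0_le:
  "variance_of (noise_hist \<mu>) (\<lambda>\<omega>. Delta0 p \<omega> j) \<le> (\<Sum>k. incr_var k (snd j))"
proof -
  interpret H: prob_space "noise_hist \<mu>" by (rule prob_space_noise_hist)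
  have "variance_of (noise_hist \<mu>) (\<lambda>\<omega>. Delta0 p \<omega> j)
      = H.expectation (\<lambda>\<omega>. (Delta0 p \<omega> j)\<^sup>2) - (H.expectation (\<lambda>\<omega>. Delta0 p \<omega> j))\<^sup>2"
    unfolding variance_of_def by (rule H.variance_eq[OF Delta0_integrable Delta0_sq_integrable])
  then show ?thesis
    using Delta0_second_moment_le[of j] zero_le_power2[of "H.expectation (\<lambda>\<omega>. Delta0 p \<omega> j)"]
    by linarith
qed

section \<open>Invariant measures with finite second moments\<close>

context
  fixes \<nu> :: "'d config measure"
  assumes \<nu>: "\<nu> \<in> invariant_measures p \<mu>"
    and sq: "\<And>j. integrable \<nu> (\<lambda>\<eta>. (\<eta> j)\<^sup>2)"
begin

lemma measurable_invariant_cong: "borel_measurable \<nu> = borel_measurable config_space"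
  by (rule measurable_cong_sets[OF invariant_measuresD(2)[OF \<nu>] refl])

lemma invariant_coord_integrable: "integrable \<nu> (\<lambda>\<eta>. \<eta> j)"
proof -
  interpret N: prob_space \<nu> by (rule invariant_measuresD(1)[OF \<nu>])
  show ?thesis
    by (rule N.square_integrable_imp_integrable[OF _ sq]) (simp add: measurable_invariant_cong)
qed

lemma tavg_pow_sq_integrable: "integrable \<nu> (\<lambda>\<eta>. ((tavg p ^^ n) \<eta> j)\<^sup>2)"
proof (induction n arbitrary: j)
  case (Suc n)
  obtain x i where j: "j = (x, i)" by (cases j)
  show ?case
    unfolding j funpow.simps comp_def tavg_eq_sum
    using Suc by (intro integrable_sum_square) (auto simp: power_mult_distrib measurable_invariant_cong)
qed (simp add: sq)

text \<open>The noise part of the chain is centred and independent of \<open>\<eta>\<close>. Since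
  \<open>c\<close> is arbitrary, it can be set to the mean of \<open>\<eta> j\<close>, which makes
  the left side the variance without first finding the mean of \<open>P^n \<eta>\<close>.\<close>

lemma chain_second_moment:
  "(\<integral>\<eta>. (\<eta> j - c)\<^sup>2 \<partial>\<nu>)
    = (\<integral>\<eta>. ((tavg p ^^ n) \<eta> j - c)\<^sup>2 \<partial>\<nu>) + (\<Sum>k<n. incr_var k (snd j))"
proof -
  interpret N: prob_space \<nu> by (rule invariant_measuresD(1)[OF \<nu>])
  interpret H: prob_space "noise_hist \<mu>" by (rule prob_space_noise_hist)
  have shift: "integrable \<nu> (\<lambda>\<eta>. ((tavg p ^^ n) \<eta> j - c)\<^sup>2)" for n
    using integrable_add_square[OF _ _ tavg_pow_sq_integrable[of n j], where g="\<lambda>_. - c"]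
    by (simp add: measurable_invariant_cong)
  have S: "integrable (noise_hist \<mu>) (\<lambda>\<omega>. (\<Sum>k<n. incr p k \<omega> j)\<^sup>2)"
    by (intro integrable_sum_square incr_sq_integrable) simp
  have S0: "(\<integral>\<omega>. (\<Sum>k<n. incr p k \<omega> j) \<partial>noise_hist \<mu>) = 0"
    by (subst Bochner_Integration.integral_sum)
      (auto simp: incr_mean intro!: H.square_integrable_imp_integrable[OF _ incr_sq_integrable])
  have "ennreal (\<integral>\<eta>. (\<eta> j - c)\<^sup>2 \<partial>\<nu>) = (\<integral>\<^sup>+\<eta>. ennreal ((\<eta> j - c)\<^sup>2) \<partial>\<nu>)"
    using shift[of 0] by (subst nn_integral_eq_integral) simp_all
  also have "\<dots> = (\<integral>\<^sup>+\<eta>. \<integral>\<^sup>+\<omega>. ennreal ((chain p n \<eta> \<omega> j - c)\<^sup>2) \<partial>noise_hist \<mu> \<partial>\<nu>)"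
    by (rule nn_integral_chain[OF \<nu>, symmetric]) measurable
  also have "\<dots> = (\<integral>\<^sup>+\<eta>. \<integral>\<^sup>+\<omega>. ennreal ((((tavg p ^^ n) \<eta> j - c) + (\<Sum>k<n. incr p k \<omega> j))\<^sup>2)
      \<partial>noise_hist \<mu> \<partial>\<nu>)"
    by (simp add: chain_def algebra_simps)
  also have "\<dots> = ennreal ((\<integral>\<eta>. ((tavg p ^^ n) \<eta> j - c)\<^sup>2 \<partial>\<nu>)
      + (\<integral>\<omega>. (\<Sum>k<n. incr p k \<omega> j)\<^sup>2 \<partial>noise_hist \<mu>))"
    by (rule nn_integral_indep_shift_sq[OF H.prob_space_axioms _ _ shift N.prob_space_axioms S S0])
      (simp_all add: measurable_invariant_cong)
  also have "(\<integral>\<omega>. (\<Sum>k<n. incr p k \<omega> j)\<^sup>2 \<partial>noise_hist \<mu>) = (\<Sum>k<n. incr_var k (snd j))"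
    by (simp add: H.expectation_indep_sum_sq[OF indep_vars_incr incr_sq_integrable incr_mean]
        incr_second_moment)
  finally show ?thesis
    by (subst (asm) ennreal_inj) (auto intro!: add_nonneg_nonneg sum_nonneg incr_var_nonneg)
qed

lemma variance_invariant_ge_sum: "(\<Sum>k. incr_var k (snd j)) \<le> variance_of \<nu> (\<lambda>\<eta>. \<eta> j)"
proof (rule suminf_le_const[OF summable_incr_var])
  fix n
  show "(\<Sum>k<n. incr_var k (snd j)) \<le> variance_of \<nu> (\<lambda>\<eta>. \<eta> j)"
    unfolding variance_of_def chain_second_moment[of j _ n] by simp
qed

text \<open>The sum of \<open>incr_var\<close> lies between the two sides: Fatou puts the variance
  of \<open>Delta0\<close> below it, invariance puts that of \<open>\<nu>\<close> above it.\<close>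

lemma variance_invariant_ge:
  "variance_of (pi_u p \<mu> u) (\<lambda>\<eta>. \<eta> j) \<le> variance_of \<nu> (\<lambda>\<eta>. \<eta> j)"
  unfolding pi_u_variance using variance_Delta0_le variance_invariant_ge_sum by (rule order_trans)

text \<open>Expectations are taken in one step of the chain: the noise is centred and the kernel sum
  is finite.\<close>

lemma invariant_mean_harmonic: "(\<lambda>i x. \<integral>\<eta>. \<eta> (x, i) \<partial>\<nu>) \<in> harmonic_d p"
proof -
  interpret N: prob_space \<nu> by (rule invariant_measuresD(1)[OF \<nu>])
  interpret F: prob_space "noise_field \<mu> :: (int ^ 'd \<Rightarrow> real) measure" by (rule prob_space_noise_field)
  note s[measurable_cong] = invariant_measuresD(2)[OF \<nu>]
  note fst = integrable_pair_fst[OF F.prob_space_axioms, where M=\<nu>] integral_pair_fst[OF F.prob_space_axioms, where M=\<nu>]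
    and snd = integrable_pair_snd[OF N.prob_space_axioms F.prob_space_axioms] integral_pair_snd[OF N.prob_space_axioms F.prob_space_axioms]
  let ?Q = "\<nu> \<Otimes>\<^sub>M (noise_field \<mu> :: (int ^ 'd \<Rightarrow> real) measure)"
  have eq: "(\<integral>\<eta>. \<eta> (x, i) \<partial>\<nu>) = (\<Sum>y\<in>ksupp p. p y * (\<integral>\<eta>. \<eta> (x + y, i) \<partial>\<nu>))" for x i
  proof -
    have t: "integrable \<nu> (\<lambda>\<eta>. tavg p \<eta> (x, i))"
      unfolding tavg_eq_sum by (simp add: invariant_coord_integrable)
    have "(\<integral>\<eta>. \<eta> (x, i) \<partial>\<nu>)
        = (\<integral>\<eta>. \<eta> (x, i) \<partial>distr (\<nu> \<Otimes>\<^sub>M noise_field \<mu>) config_space (\<lambda>(\<eta>, \<xi>). step p \<eta> \<xi>))"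
      using \<nu> by (simp add: invariant_measures_def)
    also have "\<dots> = (\<integral>q. tavg p (fst q) (x, i) + snd q x - snd q (x - unitv i) \<partial>?Q)"
      by (subst integral_distr) (auto simp: split_beta' step_eq_tavg)
    also have "\<dots> = (\<integral>q. tavg p (fst q) (x, i) \<partial>?Q)"
      using t by (simp add: fst[of "\<lambda>\<eta>. tavg p \<eta> (x, i)"] snd[of "\<lambda>\<xi>. \<xi> _"] noise_field_coord)
    also have "\<dots> = (\<integral>\<eta>. tavg p \<eta> (x, i) \<partial>\<nu>)"
      by (rule fst(2)) measurable
    also have "\<dots> = (\<Sum>y\<in>ksupp p. p y * (\<integral>\<eta>. \<eta> (x + y, i) \<partial>\<nu>))"
      unfolding tavg_eq_sum by (simp add: Bochner_Integration.integral_sum invariant_coord_integrable)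
    finally show ?thesis .
  qed
  show ?thesis
    unfolding harmonic_d_def harmonic_def mem_Collect_eq infsum_kernel[OF ker]
    by (intro allI) (rule eq[symmetric])
qed

text \<open>On the product of \<open>\<nu>\<close> with the noise histories, the
  \<open>n\<close>-step chain has law \<open>\<nu>\<close> for every \<open>n\<close>, while its
  distance to \<open>m + Delta0\<close> splits into \<open>f n\<close>, the fluctuation of
  \<open>P^n \<eta>\<close>, and \<open>g n\<close>, minus the tail of the series. One and the same
  tail of \<open>incr_var\<close> bounds both second moments.\<close>

lemma invariant_eq_pi_u:
  assumes var: "\<And>j. variance_of \<nu> (\<lambda>\<eta>. \<eta> j) \<le> variance_of (noise_hist \<mu>) (\<lambda>\<omega>. Delta0 p \<omega> j)"
  shows "\<nu> = pi_u p \<mu> (\<lambda>i x. \<integral>\<eta>. \<eta> (x, i) \<partial>\<nu>)"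
proof -
  interpret N: prob_space \<nu> by (rule invariant_measuresD(1)[OF \<nu>])
  interpret H: prob_space "noise_hist \<mu>" by (rule prob_space_noise_hist)
  interpret Q: pair_prob_space \<nu> "noise_hist \<mu>" ..
  note s[measurable_cong] = invariant_measuresD(2)[OF \<nu>]
  define m where "m j = (\<integral>\<eta>. \<eta> j \<partial>\<nu>)" for j
  define r where "r n i = (\<Sum>k. incr_var (k + n) i)" for n i
  have r0: "(\<lambda>n. r n i) \<longlonglongrightarrow> 0" for i
    unfolding r_def by (rule suminf_exist_split2[OF summable_incr_var])
  define f where "f n j \<eta> = (tavg p ^^ n) \<eta> j - m j" for n j and \<eta> :: "'d config"
  define g where "g n j \<omega> = (\<Sum>k<n. incr p k \<omega> j) - Delta0 p \<omega> j" for n j \<omega>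
  have fm[measurable]: "f n j \<in> borel_measurable \<nu>" for n j
    unfolding f_def by measurable
  have gm[measurable]: "g n j \<in> borel_measurable (noise_hist \<mu>)" for n j
    unfolding g_def by measurable
  have f2: "integrable \<nu> (\<lambda>\<eta>. (f n j \<eta>)\<^sup>2)" for n j
    using integrable_add_square[OF _ _ tavg_pow_sq_integrable[of n j], where g="\<lambda>_. - m j"]
    by (simp add: f_def)
  have g2: "integrable (noise_hist \<mu>) (\<lambda>\<omega>. (g n j \<omega>)\<^sup>2)" for n j
    using Delta0_tail_integrable[of j n] by (simp add: g_def power2_commute)
  have f1: "integrable \<nu> (f n j)" and g1: "integrable (noise_hist \<mu>) (g n j)" for n j
    using N.square_integrable_imp_integrable[OF fm f2] H.square_integrable_imp_integrable[OF gm g2]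
    by auto
  \<comment> \<open>The variance hypothesis enters here: the variance of \<open>\<nu>\<close> is at
    most the full sum of \<open>incr_var\<close>, and the first \<open>n\<close> terms are already
    taken up by the noise part.\<close>
  have f_le: "(\<integral>\<eta>. (f n j \<eta>)\<^sup>2 \<partial>\<nu>) \<le> r n (snd j)" for n j
  proof -
    have "(\<integral>\<eta>. (f n j \<eta>)\<^sup>2 \<partial>\<nu>) = variance_of \<nu> (\<lambda>\<eta>. \<eta> j) - (\<Sum>k<n. incr_var k (snd j))"
      unfolding variance_of_def f_def m_def chain_second_moment[of j _ n] by simp
    also have "\<dots> \<le> (\<Sum>k. incr_var k (snd j)) - (\<Sum>k<n. incr_var k (snd j))"
      using var[of j] variance_Delta0_le[of j] by linarith
    also have "\<dots> = r n (snd j)"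
      using suminf_split_initial_segment[OF summable_incr_var, of "snd j" n] by (simp add: r_def)
    finally show ?thesis .
  qed
  have g_le: "(\<integral>\<omega>. (g n j \<omega>)\<^sup>2 \<partial>noise_hist \<mu>) \<le> r n (snd j)" for n j
    unfolding g_def r_def by (subst power2_commute) (rule Delta0_tail_le)
  note fst = integrable_pair_fst[OF H.prob_space_axioms, where M=\<nu>] integral_pair_fst[OF H.prob_space_axioms, where M=\<nu>]
    and snd = integrable_pair_snd[OF N.prob_space_axioms H.prob_space_axioms] integral_pair_snd[OF N.prob_space_axioms H.prob_space_axioms]
  let ?Q = "\<nu> \<Otimes>\<^sub>M (noise_hist \<mu> :: (nat \<times> (int ^ 'd) \<Rightarrow> real) measure)"
  define Rn where "Rn n q = chain p n (fst q) (snd q)" for n and q :: "'d config \<times> (nat \<times> (int ^ 'd) \<Rightarrow> real)"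
  define G where "G \<omega> = (\<lambda>j. m j + Delta0 p \<omega> j)" for \<omega>
  have G[measurable]: "G \<in> measurable (noise_hist \<mu>) config_space"
    unfolding G_def by (rule measurable_config_spaceI) simp
  have R: "Rn n q j - G (snd q) j = f n j (fst q) + g n j (snd q)" for n q j
    by (simp add: Rn_def G_def f_def g_def chain_def)
  have "distr ?Q config_space (\<lambda>q. G (snd q)) = \<nu>"
    unfolding config_space_def
  proof (rule distr_PiM_eq_of_L1_limit[where Rn=Rn])
    show "prob_space ?Q" by (rule Q.P.prob_space_axioms)
    show "Rn n \<in> measurable ?Q (PiM UNIV (\<lambda>_. borel))" for n
      using measurable_chain[of n] unfolding Rn_def config_space_def[symmetric] by (simp add: split_beta')
    show "(\<lambda>q. G (snd q)) \<in> measurable ?Q (PiM UNIV (\<lambda>_. borel))"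
      unfolding config_space_def[symmetric] by measurable
    show "distr ?Q (PiM UNIV (\<lambda>_. borel)) (Rn n) = \<nu>" for n
      using distr_chain[OF \<nu>, of n] unfolding Rn_def config_space_def by (simp add: split_beta')
    show "integrable ?Q (\<lambda>q. Rn n q j - G (snd q) j)" for n j
      unfolding R by (simp add: fst snd f1 g1)
    fix j
    show "(\<lambda>n. \<integral>q. \<bar>Rn n q j - G (snd q) j\<bar> \<partial>?Q) \<longlonglongrightarrow> 0"
    proof (rule tendsto_sandwich[OF _ _ tendsto_const])
      show "(\<lambda>n. 2 * sqrt (r n (snd j))) \<longlonglongrightarrow> 0"
        using tendsto_mult_right_zero[OF tendsto_real_sqrt[OF r0[of "snd j"], unfolded real_sqrt_zero]] .
      show "\<forall>\<^sub>F n in sequentially. (\<integral>q. \<bar>Rn n q j - G (snd q) j\<bar> \<partial>?Q)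
          \<le> 2 * sqrt (r n (snd j))"
      proof (rule always_eventually, rule allI)
        fix n
        have fq: "integrable ?Q (\<lambda>q. f n j (fst q))"
          and gq: "integrable ?Q (\<lambda>q. g n j (snd q))"
          by (simp_all add: fst snd f1 g1)
        have "(\<integral>q. \<bar>Rn n q j - G (snd q) j\<bar> \<partial>?Q)
            \<le> (\<integral>q. \<bar>f n j (fst q)\<bar> + \<bar>g n j (snd q)\<bar> \<partial>?Q)"
          unfolding R
          by (intro integral_mono integrable_abs Bochner_Integration.integrable_add fq gq abs_triangle_ineq)
        also have "\<dots> = (\<integral>q. \<bar>f n j (fst q)\<bar> \<partial>?Q)
            + (\<integral>q. \<bar>g n j (snd q)\<bar> \<partial>?Q)"
          using fq gq by (subst Bochner_Integration.integral_add) auto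
        also have "\<dots> = (\<integral>\<eta>. \<bar>f n j \<eta>\<bar> \<partial>\<nu>) + (\<integral>\<omega>. \<bar>g n j \<omega>\<bar> \<partial>noise_hist \<mu>)"
          using fst(2)[of "\<lambda>\<eta>. \<bar>f n j \<eta>\<bar>"] snd(2)[of "\<lambda>\<omega>. \<bar>g n j \<omega>\<bar>"] by simp
        also have "\<dots> \<le> sqrt (r n (snd j)) + sqrt (r n (snd j))"
          by (intro add_mono N.expectation_abs_le_sqrt H.expectation_abs_le_sqrt fm gm f2 g2 f_le g_le)
        finally show "(\<integral>q. \<bar>Rn n q j - G (snd q) j\<bar> \<partial>?Q) \<le> 2 * sqrt (r n (snd j))"
          by simp
      qed
    qed simp
  qed
  \<comment> \<open>The limit depends on the noise component only, so the initial configuration can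
    be integrated out.\<close>
  then have "\<nu> = distr (distr ?Q (noise_hist \<mu>) snd) config_space G"
    by (subst distr_distr) (simp_all add: comp_def)
  also have "\<dots> = distr (noise_hist \<mu>) config_space G"
    by (simp add: H.distr_pair_snd[OF N.prob_space_axioms])
  also have "\<dots> = pi_u p \<mu> (\<lambda>i x. \<integral>\<eta>. \<eta> (x, i) \<partial>\<nu>)"
    by (simp add: pi_u_eq_distr G_def[abs_def] m_def)
  finally show ?thesis .
qed

end

end

end

section \<open>Mixtures and extremality\<close>

text \<open>The mixture is realised as a two-stage experiment: a Bernoulli choice of
  \<open>M\<close> or \<open>N\<close>, followed by a draw from the chosen measure.\<close>

lemma nn_integral_mixture:
  assumes b: "0 < b" "b < 1" and M: "prob_space M" "sets M = sets P" and N: "prob_space N" "sets N = sets P"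
    and mix: "\<And>A. A \<in> sets P \<Longrightarrow> emeasure P A = ennreal b * emeasure M A + ennreal (1 - b) * emeasure N A"
    and f: "f \<in> borel_measurable P"
  shows "(\<integral>\<^sup>+x. f x \<partial>P) = ennreal b * (\<integral>\<^sup>+x. f x \<partial>M) + ennreal (1 - b) * (\<integral>\<^sup>+x. f x \<partial>N)"
proof -
  define K where "K i = (if i then M else N)" for i
  have "K i \<in> space (subprob_algebra P)" for i
    using M N by (auto simp: K_def space_subprob_algebra intro: prob_space_imp_subprob_space)
  then have K: "K \<in> measurable (measure_pmf (bernoulli_pmf b)) (subprob_algebra P)"
    by simp
  have P: "P = bind (measure_pmf (bernoulli_pmf b)) K"
  proof (rule measure_eqI)
    show "sets P = sets (bind (measure_pmf (bernoulli_pmf b)) K)"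
      by (rule sets_bind[symmetric, OF sets_kernel[OF K]]) auto
    fix A assume A: "A \<in> sets P"
    have "emeasure (bind (measure_pmf (bernoulli_pmf b)) K) A
        = (\<integral>\<^sup>+i. emeasure (K i) A \<partial>measure_pmf (bernoulli_pmf b))"
      by (rule emeasure_bind[OF _ K A]) simp
    then show "emeasure P A = emeasure (bind (measure_pmf (bernoulli_pmf b)) K) A"
      using b by (simp add: mix[OF A] K_def mult.commute)
  qed
  have "(\<integral>\<^sup>+x. f x \<partial>P) = (\<integral>\<^sup>+i. (\<integral>\<^sup>+x. f x \<partial>K i) \<partial>measure_pmf (bernoulli_pmf b))"
    by (subst P) (rule nn_integral_bind[OF f K])
  then show ?thesis using b by (simp add: K_def mult.commute)
qed

text \<open>Both weights are positive, so a finite integral under the mixture forces finite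
  integrals under both components.\<close>

lemma
  fixes f :: "'a \<Rightarrow> real"
  assumes b: "0 < b" "b < 1" and M: "prob_space M" "sets M = sets P" and N: "prob_space N" "sets N = sets P"
    and mix: "\<And>A. A \<in> sets P \<Longrightarrow> emeasure P A = ennreal b * emeasure M A + ennreal (1 - b) * emeasure N A"
    and f: "f \<in> borel_measurable P" "integrable P f" "\<And>x. 0 \<le> f x"
  shows integrable_mixture: "integrable M f" "integrable N f"
    and integral_mixture: "(\<integral>x. f x \<partial>P) = b * (\<integral>x. f x \<partial>M) + (1 - b) * (\<integral>x. f x \<partial>N)"
proof -
  have eq: "(\<integral>\<^sup>+x. ennreal (f x) \<partial>P)
      = ennreal b * (\<integral>\<^sup>+x. ennreal (f x) \<partial>M) + ennreal (1 - b) * (\<integral>\<^sup>+x. ennreal (f x) \<partial>N)"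
    using f(1) by (intro nn_integral_mixture[OF b M N mix]) auto
  have "(\<integral>\<^sup>+x. ennreal (f x) \<partial>P) < \<infinity>"
    using f by (simp add: nn_integral_eq_integral)
  then have fin: "(\<integral>\<^sup>+x. ennreal (f x) \<partial>M) < \<infinity>" "(\<integral>\<^sup>+x. ennreal (f x) \<partial>N) < \<infinity>"
    using b unfolding eq by (auto simp: ennreal_mult_eq_top_iff less_top[symmetric])
  show M': "integrable M f" and N': "integrable N f"
    using f fin by (auto intro!: integrableI_nonneg simp: measurable_cong_sets[OF M(2)] measurable_cong_sets[OF N(2)])
  have "ennreal (\<integral>x. f x \<partial>P) = ennreal (b * (\<integral>x. f x \<partial>M) + (1 - b) * (\<integral>x. f x \<partial>N))"
    using eq b f(2,3) M' N'
    by (simp add: nn_integral_eq_integral ennreal_mult[symmetric] ennreal_plus[symmetric] del: ennreal_plus)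
  then show "(\<integral>x. f x \<partial>P) = b * (\<integral>x. f x \<partial>M) + (1 - b) * (\<integral>x. f x \<partial>N)"
    using b f(3) by (subst (asm) ennreal_inj) auto
qed

text \<open>The law of total variance for a two-valued mixing variable; the last term is the
  variance of the conditional mean.\<close>

lemma
  fixes X :: "'a \<Rightarrow> real"
  assumes b: "0 < b" "b < 1" and P: "prob_space P"
    and M: "prob_space M" "sets M = sets P" and N: "prob_space N" "sets N = sets P"
    and mix: "\<And>A. A \<in> sets P \<Longrightarrow> emeasure P A = ennreal b * emeasure M A + ennreal (1 - b) * emeasure N A"
    and X[measurable]: "X \<in> borel_measurable P" and X2: "integrable P (\<lambda>x. (X x)\<^sup>2)"
  shows mean_mixture: "(\<integral>x. X x \<partial>P) = b * (\<integral>x. X x \<partial>M) + (1 - b) * (\<integral>x. X x \<partial>N)"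
    and variance_mixture: "variance_of P X = b * variance_of M X + (1 - b) * variance_of N X
      + b * (1 - b) * ((\<integral>x. X x \<partial>M) - (\<integral>x. X x \<partial>N))\<^sup>2"
proof -
  interpret P: prob_space P by fact
  interpret M: prob_space M by fact
  interpret N: prob_space N by fact
  have XM: "X \<in> borel_measurable M" and XN: "X \<in> borel_measurable N"
    using X by (simp_all add: measurable_cong_sets[OF M(2)] measurable_cong_sets[OF N(2)])
  note mixture = integrable_mixture[OF b M N mix] integral_mixture[OF b M N mix]
  note S = mixture[where f="\<lambda>x. (X x)\<^sup>2", OF _ _ X2 zero_le_power2, simplified]
  \<comment> \<open>The mixture formula holds for nonnegative integrands; \<open>X\<close> is recovered from \<open>(X + 1)\<^sup>2 - X\<^sup>2\<close>.\<close>
  have "integrable P (\<lambda>x. (X x + 1)\<^sup>2)"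
    by (rule integrable_add_square) (simp_all add: X2)
  note S' = mixture[where f="\<lambda>x. (X x + 1)\<^sup>2", OF _ _ this zero_le_power2, simplified]
  have X1: "integrable P X" "integrable M X" "integrable N X"
    using P.square_integrable_imp_integrable[OF X X2] M.square_integrable_imp_integrable[OF XM S(1)]
      N.square_integrable_imp_integrable[OF XN S(2)] by auto
  have sq: "(X x + 1)\<^sup>2 = (X x)\<^sup>2 + 2 * X x + 1" for x by (simp add: power2_sum)
  have "P.expectation (\<lambda>x. (X x + 1)\<^sup>2) = P.expectation (\<lambda>x. (X x)\<^sup>2) + 2 * P.expectation X + 1"
    "M.expectation (\<lambda>x. (X x + 1)\<^sup>2) = M.expectation (\<lambda>x. (X x)\<^sup>2) + 2 * M.expectation X + 1"
    "N.expectation (\<lambda>x. (X x + 1)\<^sup>2) = N.expectation (\<lambda>x. (X x)\<^sup>2) + 2 * N.expectation X + 1"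
    unfolding sq using X1 X2 S(1,2) by (simp_all add: P.prob_space M.prob_space N.prob_space)
  then have "2 * P.expectation X = 2 * (b * M.expectation X + (1 - b) * N.expectation X)"
    using S(3) S'(3) by (simp add: algebra_simps)
  then show mean: "P.expectation X = b * M.expectation X + (1 - b) * N.expectation X" by simp
  have v: "variance_of P X = P.expectation (\<lambda>x. (X x)\<^sup>2) - (P.expectation X)\<^sup>2"
    "variance_of M X = M.expectation (\<lambda>x. (X x)\<^sup>2) - (M.expectation X)\<^sup>2"
    "variance_of N X = N.expectation (\<lambda>x. (X x)\<^sup>2) - (N.expectation X)\<^sup>2"
    unfolding variance_of_def
    by (rule P.variance_eq[OF X1(1) X2] M.variance_eq[OF X1(2) S(1)] N.variance_eq[OF X1(3) S(2)])+
  show "variance_of P X = b * variance_of M X + (1 - b) * variance_of N X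
      + b * (1 - b) * (M.expectation X - N.expectation X)\<^sup>2"
    unfolding v S(3) mean
    by (simp add: power2_eq_square algebra_simps)
qed

text \<open>The variance bound identifies \<open>M\<close> with the measure \<open>pi_u\<close>
  built from its own mean field. Computing the mean of \<open>M\<close> through this identification
  forces the mean of \<open>Delta0\<close> to be zero, so the mean field is \<open>u\<close>
  itself.\<close>

lemma invariant_eq_pi_uI:
  fixes p :: "int ^ 'd::finite \<Rightarrow> real"
  assumes ker: "kernel p" and noise: "noise_law \<mu>" and u: "u \<in> harmonic_d p"
    and M: "M \<in> invariant_measures p \<mu>"
    and sq: "\<And>j. integrable M (\<lambda>\<eta>. (\<eta> j)\<^sup>2)"
    and var: "\<And>j. variance_of M (\<lambda>\<eta>. \<eta> j) \<le> variance_of (pi_u p \<mu> u) (\<lambda>\<eta>. \<eta> j)"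
    and mean: "\<And>j. (\<integral>\<eta>. \<eta> j \<partial>M) = (\<integral>\<eta>. \<eta> j \<partial>pi_u p \<mu> u)"
  shows "M = pi_u p \<mu> u"
proof -
  have eq: "M = pi_u p \<mu> (\<lambda>i x. \<integral>\<eta>. \<eta> (x, i) \<partial>M)"
    using var by (intro invariant_eq_pi_u[OF ker noise M sq]) (simp add: pi_u_variance[OF ker noise])
  have "(\<integral>\<eta>. \<eta> j \<partial>M) = (\<integral>\<eta>. \<eta> j \<partial>M) + (\<integral>\<omega>. Delta0 p \<omega> j \<partial>noise_hist \<mu>)" for j
    using pi_u_mean[OF ker noise, of "\<lambda>i x. \<integral>\<eta>. \<eta> (x, i) \<partial>M" j] eq by simp
  then have "(\<integral>\<omega>. Delta0 p \<omega> j \<partial>noise_hist \<mu>) = 0" for j by (metis add_cancel_left_right)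
  then have "(\<lambda>i x. \<integral>\<eta>. \<eta> (x, i) \<partial>M) = u"
    by (simp add: mean pi_u_mean[OF ker noise] fun_eq_iff)
  then show ?thesis using eq by simp
qed

lemma pi_u_extreme:
  fixes p :: "int ^ 'd::finite \<Rightarrow> real"
  assumes ker: "kernel p" and noise: "noise_law \<mu>" and u: "u \<in> harmonic_d p"
  shows "extreme_point (invariant_measures p \<mu>) (pi_u p \<mu> u)"
  unfolding extreme_point_def
proof (intro conjI[OF pi_u_invariant[OF ker noise u]] allI impI, elim conjE)
  let ?P = "pi_u p \<mu> u"
  fix b M N
  assume b: "0 < b" "b < 1" and M: "M \<in> invariant_measures p \<mu>" and N: "N \<in> invariant_measures p \<mu>"
    and mix: "\<forall>A\<in>sets ?P. emeasure ?P A = ennreal b * emeasure M A + ennreal (1 - b) * emeasure N A"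
  note D = invariant_measuresD(1,2)[OF ker noise]
  have P: "?P \<in> invariant_measures p \<mu>" by (rule pi_u_invariant[OF ker noise u])
  have s: "sets M = sets ?P" "sets N = sets ?P" using D(2)[OF M] D(2)[OF N] D(2)[OF P] by auto
  note sqP = pi_u_sq_integrable[OF ker noise, of u]
  have m: "(\<lambda>\<eta>. \<eta> j) \<in> borel_measurable ?P" for j
    by (simp add: measurable_cong_sets[OF D(2)[OF P]])
  have sqM: "integrable M (\<lambda>\<eta>. (\<eta> j)\<^sup>2)" and sqN: "integrable N (\<lambda>\<eta>. (\<eta> j)\<^sup>2)" for j
    using m[of j] mix by (auto intro!: integrable_mixture[OF b D(1)[OF M] s(1) D(1)[OF N] s(2) _ _ sqP])
  note mean = mean_mixture[OF b D(1)[OF P] D(1)[OF M] s(1) D(1)[OF N] s(2) bspec[OF mix] m sqP]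
    and var = variance_mixture[OF b D(1)[OF P] D(1)[OF M] s(1) D(1)[OF N] s(2) bspec[OF mix] m sqP]
  have *: "variance_of M (\<lambda>\<eta>. \<eta> j) \<le> variance_of ?P (\<lambda>\<eta>. \<eta> j)
      \<and> variance_of N (\<lambda>\<eta>. \<eta> j) \<le> variance_of ?P (\<lambda>\<eta>. \<eta> j)
      \<and> (\<integral>\<eta>. \<eta> j \<partial>M) = (\<integral>\<eta>. \<eta> j \<partial>N)" for j
  proof -
    define v0 vM vN d where "v0 = variance_of ?P (\<lambda>\<eta>. \<eta> j)" and "vM = variance_of M (\<lambda>\<eta>. \<eta> j)"
      and "vN = variance_of N (\<lambda>\<eta>. \<eta> j)" and "d = (\<integral>\<eta>. \<eta> j \<partial>M) - (\<integral>\<eta>. \<eta> j \<partial>N)"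
    have le: "v0 \<le> vM" "v0 \<le> vN"
      unfolding v0_def vM_def vN_def
      by (rule variance_invariant_ge[OF ker noise M sqM] variance_invariant_ge[OF ker noise N sqN])+
    \<comment> \<open>The total variance identity, rearranged: two weighted excess variances and a
      squared difference of means, all nonnegative, add up to zero, so each of them
      vanishes.\<close>
    have "b * (vM - v0) + (1 - b) * (vN - v0) + b * (1 - b) * d\<^sup>2 = 0"
      using var[of j] by (simp add: v0_def vM_def vN_def d_def algebra_simps)
    moreover have "0 \<le> b * (vM - v0)" "0 \<le> (1 - b) * (vN - v0)" "0 \<le> b * (1 - b) * d\<^sup>2"
      using b le by auto
    ultimately have "b * (vM - v0) = 0" "(1 - b) * (vN - v0) = 0" "b * (1 - b) * d\<^sup>2 = 0"
      by linarith+
    then show ?thesis using b by (simp add: v0_def vM_def vN_def d_def)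
  qed
  have meanP: "(\<integral>\<eta>. \<eta> j \<partial>M) = (\<integral>\<eta>. \<eta> j \<partial>?P)" "(\<integral>\<eta>. \<eta> j \<partial>N) = (\<integral>\<eta>. \<eta> j \<partial>?P)" for j
    using mean[of j] *[of j] by (simp_all add: algebra_simps)
  show "M = ?P \<and> N = ?P"
    using * meanP invariant_eq_pi_uI[OF ker noise u M sqM] invariant_eq_pi_uI[OF ker noise u N sqN] by blast
qed

theorem theorem2p3:
  fixes p :: "int ^ 'd::finite \<Rightarrow> real" and \<mu> :: "real measure"
  assumes "kernel p" and "noise_law \<mu>"
  shows "(\<forall>u\<in>harmonic_d p. extreme_point (invariant_measures p \<mu>) (pi_u p \<mu> u)) \<and>
    (\<forall>\<nu>\<in>invariant_measures p \<mu>.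
       (\<forall>x i. integrable \<nu> (\<lambda>\<eta>. \<eta> (x, i)) \<and> integrable \<nu> (\<lambda>\<eta>. (\<eta> (x, i))\<^sup>2)) \<longrightarrow>
       (\<forall>x i. variance_of \<nu> (\<lambda>\<eta>. \<eta> (x, i)) \<ge> variance_of (pi_u p \<mu> (\<lambda>_ _. 0)) (\<lambda>\<eta>. \<eta> (x, i))) \<and>
       ((\<forall>x i. variance_of \<nu> (\<lambda>\<eta>. \<eta> (x, i)) = variance_of (pi_u p \<mu> (\<lambda>_ _. 0)) (\<lambda>\<eta>. \<eta> (x, i)))
          \<longleftrightarrow> (\<exists>u\<in>harmonic_d p. \<nu> = pi_u p \<mu> u)))"
proof (intro conjI ballI impI)
  fix u assume "u \<in> harmonic_d p"
  then show "extreme_point (invariant_measures p \<mu>) (pi_u p \<mu> u)"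
    by (rule pi_u_extreme[OF assms])
next
  fix \<nu> :: "'d config measure"
  assume \<nu>: "\<nu> \<in> invariant_measures p \<mu>"
    and "\<forall>x i. integrable \<nu> (\<lambda>\<eta>. \<eta> (x, i)) \<and> integrable \<nu> (\<lambda>\<eta>. (\<eta> (x, i))\<^sup>2)"
  then have sq: "integrable \<nu> (\<lambda>\<eta>. (\<eta> j)\<^sup>2)" for j by (cases j) blast
  show "\<forall>x i. variance_of \<nu> (\<lambda>\<eta>. \<eta> (x, i)) \<ge> variance_of (pi_u p \<mu> (\<lambda>_ _. 0)) (\<lambda>\<eta>. \<eta> (x, i))"
    by (intro allI variance_invariant_ge[OF assms \<nu> sq])
  show "(\<forall>x i. variance_of \<nu> (\<lambda>\<eta>. \<eta> (x, i)) = variance_of (pi_u p \<mu> (\<lambda>_ _. 0)) (\<lambda>\<eta>. \<eta> (x, i)))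
      \<longleftrightarrow> (\<exists>u\<in>harmonic_d p. \<nu> = pi_u p \<mu> u)"
  proof
    assume eq: "\<forall>x i. variance_of \<nu> (\<lambda>\<eta>. \<eta> (x, i)) = variance_of (pi_u p \<mu> (\<lambda>_ _. 0)) (\<lambda>\<eta>. \<eta> (x, i))"
    have "variance_of \<nu> (\<lambda>\<eta>. \<eta> j) \<le> variance_of (noise_hist \<mu>) (\<lambda>\<omega>. Delta0 p \<omega> j)" for j
      using eq by (cases j) (simp add: pi_u_variance[OF assms])
    then have "\<nu> = pi_u p \<mu> (\<lambda>i x. \<integral>\<eta>. \<eta> (x, i) \<partial>\<nu>)"
      by (rule invariant_eq_pi_u[OF assms \<nu> sq])
    then show "\<exists>u\<in>harmonic_d p. \<nu> = pi_u p \<mu> u"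
      using invariant_mean_harmonic[OF assms \<nu> sq] by blast
  next
    assume "\<exists>u\<in>harmonic_d p. \<nu> = pi_u p \<mu> u"
    then show "\<forall>x i. variance_of \<nu> (\<lambda>\<eta>. \<eta> (x, i)) = variance_of (pi_u p \<mu> (\<lambda>_ _. 0)) (\<lambda>\<eta>. \<eta> (x, i))"
      by (auto simp: pi_u_variance[OF assms])
  qed
qed

end
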